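(* Let $G_1$ be an $r_1$-regular graph of order $n_1$, where $r_1\ge1$, and let $G_2$ be an $r_2$-regular graph of order $n_2$. Let $S=\{i\in\{2,3,\dots,n_1\}:\delta_i(G_1)=1+\tfrac1{r_1}\}$ and let $n(S)$ be the cardinality of $S$. All spectra below are with multiplicities. (a) If $S=\emptyset$, then the normalized Laplacian spectrum of $G_1\underset{=}{\vee}G_2$ consists of: (i) $1+\dfrac{r_2(\delta_i(G_2)-1)}{n_1+r_2}$ for each $i=2,3,\dots,n_2$; (ii) the two values (one for each choice of sign) $$1+\frac{2\left(1+r_1-r_1\delta_i(G_1)\right)^2}{r_1(1-\delta_i(G_1))(n_1-r_1-1)\mp\sqrt{(n_1-r_1-1)\left[r_1^2(1-\delta_i(G_1))^2(n_1-r_1-1)+4(1+r_1-r_1\delta_i(G_1))^2(n_1+n_2-1)\right]}}$$ for each $i=2,3,\dots,n_1$; (iii) the three roots of the equation $$\begin{aligned}&(n_1^2+n_1n_2-n_1+r_2n_1+r_2n_2-r_2)x^3\\&-(3n_1^2+3n_1n_2-3n_1-r_1n_1+2r_2n_1+2r_2n_2-2r_2-r_1r_2)x^2\\&+(2n_1^2+2n_1n_2-2n_1-r_1n_1+r_2n_2)x=0.\end{aligned}$$ (b) If $S=\{2,3,\dots,n_1\}$, then the normalized Laplacian spectrum of $G_1\underset{=}{\vee}G_2$ consists of: (i) $1+\dfrac{r_2(\delta_i(G_2)-1)}{n_1+r_2}$ for each $i=2,3,\dots,n_2$; (ii) $1+\dfrac1{n_1+n_2-1}$ with multiplicity $n_1-1$,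 $0$ with multiplicity $n_1+1$, and $\dfrac{n_1^2+2n_1n_2+r_2n_2-n_1}{(r_2+n_1)(n_1+n_2-1)}$. (c) If $S\ne\emptyset$ and $S\ne\{2,3,\dots,n_1\}$, then the normalized Laplacian spectrum of $G_1\underset{=}{\vee}G_2$ consists of: (i) $1+\dfrac{r_2(\delta_i(G_2)-1)}{n_1+r_2}$ for each $i=2,3,\dots,n_2$; (ii) the two values (one for each choice of sign) $$1+\frac{2\left(1+r_1-r_1\delta_i(G_1)\right)^2}{r_1(1-\delta_i(G_1))(n_1-r_1-1)\mp\sqrt{(n_1-r_1-1)\left[r_1^2(1-\delta_i(G_1))^2(n_1-r_1-1)+4(1+r_1-r_1\delta_i(G_1))^2(n_1+n_2-1)\right]}}$$ for each $i\in\{2,3,\dots,n_1\}\setminus S$; (iii) $1$ with multiplicity $n(S)$ and $1+\dfrac1{n_1+n_2-1}$ with multiplicity $n(S)$; (iv) the three roots of the equation $$\begin{aligned}&(n_1^2+n_1n_2-n_1+r_2n_1+r_2n_2-r_2)x^3\\&-(3n_1^2+3n_1n_2-3n_1-r_1n_1+2r_2n_1+2r_2n_2-2r_2-r_1r_2)x^2\\&+(2n_1^2+2n_1n_2-2n_1-r_1n_1+r_2n_2)x=0.\end{aligned}$$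
   Context: Graphs are finite, undirected and simple. With $A(G)$ the adjacency matrix and $D(G)$ the diagonal degree matrix, the normalized Laplacian is $\mathcal L(G)=I-D(G)^{-1/2}A(G)D(G)^{-1/2}$, with the convention that for a vertex of degree $0$ one sets $d_i^{-1/2}=0$ and the corresponding diagonal entry of $\mathcal L(G)$ is $0$ (diagonal entries are $1$ at vertices of nonzero degree). The normalized Laplacian spectrum is the multiset of eigenvalues of $\mathcal L(G)$, and $0=\delta_1(G)\le\delta_2(G)\le\dots\le\delta_n(G)$ denote these eigenvalues. In each part, the multiplicity of an eigenvalue is the total number of times it occurs over all items of the list. For vertex-disjoint graphs $G_1$ (with $V(G_1)=\{u_1,\dots,u_{n_1}\}$) and $G_2$, the join $G_1\vee G_2$ is the disjoint union together with all edges between $V(G_1)$ and $V(G_2)$. The NNS (Non Neighbors Splitting) join $G_1\underset{=}{\vee}G_2$ is obtained from $G_1\vee G_2$ by adding new vertices $u_1',\dots,u_{n_1}'$ and joining $u_i'$ to $u_j$ if and only if $i\ne j$ and $u_iu_j\notin E(G_1)$. *)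

theory Defs
  imports
    "Graph_Theory.Pair_Digraph"
    "Jordan_Normal_Form.Char_Poly"
    "HOL-Combinatorics.List_Permutation"
begin

text \<open>
  Finite simple undirected graphs are the \<^locale>\<open>pair_graph\<close>s of the Graph Theory library: finite,
  loop-free and symmetric sets of pairs, so that an edge \<open>uv\<close> is the pair of arcs \<open>(u, v)\<close>, \<open>(v, u)\<close>
  and the degree of a vertex is its out-degree.
\<close>

abbreviation graph_degree :: "'a pair_pre_digraph \<Rightarrow> 'a \<Rightarrow> nat" where
  "graph_degree G v \<equiv> out_degree (with_proj G) v"

definition regular_graph :: "'a pair_pre_digraph \<Rightarrow> nat \<Rightarrow> bool" where
  "regular_graph G r \<longleftrightarrow> (\<forall>v \<in> pverts G. graph_degree G v = r)"


section \<open>Join and NNS join\<close>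

text \<open>Disjointness of the two vertex sets is built in by the use of sum types.\<close>

definition graph_join ::
    "'a pair_pre_digraph \<Rightarrow> 'b pair_pre_digraph \<Rightarrow> ('a + 'b) pair_pre_digraph" where
  "graph_join G H =
    \<lparr> pverts = pverts G <+> pverts H,
      parcs = {(Inl u, Inl v) | u v. (u, v) \<in> parcs G}
            \<union> {(Inr u, Inr v) | u v. (u, v) \<in> parcs H}
            \<union> {(Inl u, Inr v) | u v. u \<in> pverts G \<and> v \<in> pverts H}
            \<union> {(Inr v, Inl u) | u v. u \<in> pverts G \<and> v \<in> pverts H} \<rparr>"

text \<open>\<open>Inl\<close> embeds the join; \<open>Inr u\<close> is the new vertex \<open>u'\<close> belonging to the vertex \<open>u\<close> of \<open>G\<close>.\<close>

definition nns_join ::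
    "'a pair_pre_digraph \<Rightarrow> 'b pair_pre_digraph \<Rightarrow> (('a + 'b) + 'a) pair_pre_digraph" where
  "nns_join G H =
    \<lparr> pverts = pverts (graph_join G H) <+> pverts G,
      parcs = {(Inl x, Inl y) | x y. (x, y) \<in> parcs (graph_join G H)}
            \<union> {(Inr u, Inl (Inl v)) | u v.
                 u \<in> pverts G \<and> v \<in> pverts G \<and> u \<noteq> v \<and> (u, v) \<notin> parcs G}
            \<union> {(Inl (Inl v), Inr u) | u v.
                 u \<in> pverts G \<and> v \<in> pverts G \<and> u \<noteq> v \<and> (u, v) \<notin> parcs G} \<rparr>"

lemma pair_graph_graph_join:
  assumes "pair_graph G" "pair_graph H"
  shows "pair_graph (graph_join G H)"
proof -
  interpret G: pair_graph G by fact
  interpret H: pair_graph H by fact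
  let ?J = "graph_join G H"
  have fin: "finite (pverts ?J)"
    by (simp add: graph_join_def G.pair_finite_verts H.pair_finite_verts)
  have sub: "parcs ?J \<subseteq> pverts ?J \<times> pverts ?J"
    by (auto simp: graph_join_def dest: G.in_arcsD1 G.in_arcsD2 H.in_arcsD1 H.in_arcsD2)
  have "finite (parcs ?J)"
    using sub fin by (meson finite_SigmaI finite_subset)
  moreover have "symmetric (with_proj ?J)"
    by (auto simp: symmetric_def graph_join_def intro!: symI
          dest: G.arcs_symmetric H.arcs_symmetric)
  moreover have "fst e \<noteq> snd e" if "e \<in> parcs ?J" for e
    using that by (auto simp: graph_join_def dest: G.no_loops' H.no_loops')
  ultimately show ?thesis
    using fin sub by unfold_locales auto
qed

lemma pair_graph_nns_join:
  assumes "pair_graph G" "pair_graph H"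
  shows "pair_graph (nns_join G H)"
proof -
  interpret G: pair_graph G by fact
  interpret J: pair_graph "graph_join G H" using assms by (rule pair_graph_graph_join)
  let ?J = "nns_join G H"
  have inl: "Inl v \<in> pverts (graph_join G H) \<longleftrightarrow> v \<in> pverts G" for v
    by (auto simp: graph_join_def)
  have fin: "finite (pverts ?J)"
    by (simp add: nns_join_def G.pair_finite_verts J.pair_finite_verts)
  have sub: "parcs ?J \<subseteq> pverts ?J \<times> pverts ?J"
    by (auto simp: nns_join_def inl dest: J.in_arcsD1 J.in_arcsD2)
  have "finite (parcs ?J)"
    using sub fin by (meson finite_SigmaI finite_subset)
  moreover have "symmetric (with_proj ?J)"
    by (auto simp: symmetric_def nns_join_def intro!: symI dest: J.arcs_symmetric)
  moreover have "fst e \<noteq> snd e" if "e \<in> parcs ?J" for e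
    using that by (auto simp: nns_join_def dest: J.no_loops')
  ultimately show ?thesis
    using fin sub by unfold_locales auto
qed


section \<open>The normalized Laplacian\<close>

text \<open>All matrices are taken with respect to a listing \<open>vs\<close> of the vertices.\<close>

definition adjacency_mat :: "'a pair_pre_digraph \<Rightarrow> 'a list \<Rightarrow> real mat" where
  "adjacency_mat G vs = mat (length vs) (length vs)
     (\<lambda>(i, j). if (vs ! i, vs ! j) \<in> parcs G then 1 else 0)"

definition inv_sqrt_degree_mat :: "'a pair_pre_digraph \<Rightarrow> 'a list \<Rightarrow> real mat" where
  "inv_sqrt_degree_mat G vs = mat (length vs) (length vs)
     (\<lambda>(i, j). if i = j \<and> graph_degree G (vs ! i) \<noteq> 0
        then 1 / sqrt (real (graph_degree G (vs ! i))) else 0)"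

text \<open>
  The identity matrix, but with diagonal entry \<open>0\<close> at isolated vertices: this implements the
  convention that the diagonal entry of the normalized Laplacian is \<open>0\<close> there.
\<close>

definition nonisolated_id_mat :: "'a pair_pre_digraph \<Rightarrow> 'a list \<Rightarrow> real mat" where
  "nonisolated_id_mat G vs = mat (length vs) (length vs)
     (\<lambda>(i, j). if i = j \<and> graph_degree G (vs ! i) \<noteq> 0 then 1 else 0)"

definition normalized_laplacian :: "'a pair_pre_digraph \<Rightarrow> 'a list \<Rightarrow> real mat" where
  "normalized_laplacian G vs =
     nonisolated_id_mat G vs
       - inv_sqrt_degree_mat G vs * adjacency_mat G vs * inv_sqrt_degree_mat G vs"

text \<open>
  The eigenvalues with multiplicity are the roots of the characteristic polynomial. The matrix is
  real symmetric, so no eigenvalue is lost by working over the reals. The choice of the listing is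
  irrelevant, see \<open>normalized_laplacian_spectrum_eq\<close> below.
\<close>

definition normalized_laplacian_spectrum :: "'a pair_pre_digraph \<Rightarrow> real multiset" where
  "normalized_laplacian_spectrum G =
     proots (char_poly (normalized_laplacian G (SOME vs. distinct vs \<and> set vs = pverts G)))"

lemma char_poly_permute:
  fixes f :: "nat \<Rightarrow> nat \<Rightarrow> 'c :: comm_ring_1"
  assumes p: "p permutes {..<n}"
  shows "char_poly (mat n n (\<lambda>(i, j). f (p i) (p j))) = char_poly (mat n n (\<lambda>(i, j). f i j))"
proof -
  have lt: "p i < n \<longleftrightarrow> i < n" for i
    using permutes_in_image[OF p, of i] by simp
  have inj: "p i = p j \<longleftrightarrow> i = j" for i j
    using permutes_inj[OF p] by (auto dest: injD)
  define P :: "'c mat" where "P = mat n n (\<lambda>(i, j). if j = p i then 1 else 0)"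
  define Q :: "'c mat" where "Q = mat n n (\<lambda>(i, j). if i = p j then 1 else 0)"
  define A where "A = mat n n (\<lambda>(i, j). f i j)"
  have carr: "P \<in> carrier_mat n n" "Q \<in> carrier_mat n n" "A \<in> carrier_mat n n"
    by (simp_all add: P_def Q_def A_def)
  have PQ: "P * Q = 1\<^sub>m n"
    by (rule eq_matI)
      (auto simp: P_def Q_def scalar_prod_def lt inj if_distrib[of "\<lambda>x. x * _"] sum.delta
            cong: if_cong)
  have PA: "P * A = mat n n (\<lambda>(i, j). f (p i) j)"
    by (rule eq_matI)
      (auto simp: P_def A_def scalar_prod_def lt if_distrib[of "\<lambda>x. x * _"] sum.delta
            cong: if_cong)
  have PAQ: "mat n n (\<lambda>(i, j). f (p i) (p j)) = P * A * Q"
    unfolding PA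
    by (rule eq_matI)
      (auto simp: Q_def scalar_prod_def lt if_distrib[of "\<lambda>x. _ * x"] sum.delta
            cong: if_cong)
  have QP: "Q * P = 1\<^sub>m n"
  proof (rule eq_matI)
    fix i j assume ij: "i < dim_row (1\<^sub>m n :: 'c mat)" "j < dim_col (1\<^sub>m n :: 'c mat)"
    have "(Q * P) $$ (i, j) = (\<Sum>k = 0..<n. if i = p k \<and> j = p k then 1 else 0)"
      using ij by (auto simp: P_def Q_def scalar_prod_def intro!: sum.cong)
    also have "\<dots> = (\<Sum>k = 0..<n. if k = inv_into UNIV p i then (if i = j then 1 else 0) else 0)"
      by (intro sum.cong) (auto simp: permutes_inverses[OF p])
    also have "\<dots> = (if i = j then 1 else 0)"
      using ij permutes_in_image[OF permutes_inv[OF p], of i] by simp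
    finally show "(Q * P) $$ (i, j) = 1\<^sub>m n $$ (i, j)" using ij by simp
  qed (simp_all add: P_def Q_def)
  have "similar_mat (mat n n (\<lambda>(i, j). f (p i) (p j))) A"
    by (rule similar_matI[of _ _ P Q n]) (use carr PQ QP PAQ in auto)
  then show ?thesis unfolding A_def by (rule char_poly_similar)
qed

lemma normalized_laplacian_entries:
  "normalized_laplacian G vs = mat (length vs) (length vs) (\<lambda>(i, j).
     (if i = j \<and> graph_degree G (vs ! i) \<noteq> 0 then 1 else 0) -
     (if (vs ! i, vs ! j) \<in> parcs G
      then 1 / sqrt (real (graph_degree G (vs ! i))) * (1 / sqrt (real (graph_degree G (vs ! j))))
      else 0))"
proof -
  let ?n = "length vs"
  let ?d = "\<lambda>i. 1 / sqrt (real (graph_degree G (vs ! i)))"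
  let ?a = "\<lambda>i j. if (vs ! i, vs ! j) \<in> parcs G then 1 else 0 :: real"
  have D: "inv_sqrt_degree_mat G vs = mat ?n ?n (\<lambda>(i, j). if i = j then ?d i else 0)"
    by (rule eq_matI) (auto simp: inv_sqrt_degree_mat_def)
  have DA: "inv_sqrt_degree_mat G vs * adjacency_mat G vs = mat ?n ?n (\<lambda>(i, j). ?d i * ?a i j)"
    unfolding D adjacency_mat_def
    by (rule eq_matI)
      (simp_all add: scalar_prod_def if_distrib[of "\<lambda>x. x * _"] sum.delta cong: if_cong)
  have DAD: "inv_sqrt_degree_mat G vs * adjacency_mat G vs * inv_sqrt_degree_mat G vs
      = mat ?n ?n (\<lambda>(i, j). ?d i * ?a i j * ?d j)"
    unfolding DA unfolding D
    by (rule eq_matI)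
      (simp_all add: scalar_prod_def if_distrib[of "\<lambda>x. _ * x"] sum.delta cong: if_cong)
  show ?thesis
    unfolding normalized_laplacian_def DAD nonisolated_id_mat_def
    by (rule eq_matI) auto
qed

lemma normalized_laplacian_spectrum_eq:
  assumes "distinct vs" "set vs = pverts G"
  shows "normalized_laplacian_spectrum G = proots (char_poly (normalized_laplacian G vs))"
proof -
  define ws where "ws = (SOME ws. distinct ws \<and> set ws = pverts G)"
  have ws: "distinct ws" "set ws = pverts G"
    using someI[of "\<lambda>ws. distinct ws \<and> set ws = pverts G" vs] assms by (simp_all add: ws_def)
  have "mset ws = mset vs"
    using assms ws by (simp add: set_eq_iff_mset_eq_distinct[symmetric])
  then obtain p where p: "p permutes {..<length vs}" and perm: "permute_list p vs = ws"
    by (metis mset_eq_permutation)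
  have len: "length ws = length vs" using perm by (metis length_permute_list)
  have nth: "ws ! i = vs ! p i" if "i < length vs" for i
    using perm p that by (metis permute_list_nth)
  have inj: "p i = p j \<longleftrightarrow> i = j" for i j
    using permutes_inj[OF p] by (auto dest: injD)
  let ?f = "\<lambda>i j. (if i = j \<and> graph_degree G (vs ! i) \<noteq> 0 then 1 else 0) -
     (if (vs ! i, vs ! j) \<in> parcs G
      then 1 / sqrt (real (graph_degree G (vs ! i))) * (1 / sqrt (real (graph_degree G (vs ! j))))
      else 0)"
  have "normalized_laplacian G ws = mat (length vs) (length vs) (\<lambda>(i, j). ?f (p i) (p j))"
    unfolding normalized_laplacian_entries len
    by (rule eq_matI) (simp_all add: nth inj)
  then have "char_poly (normalized_laplacian G ws) = char_poly (normalized_laplacian G vs)"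
    using char_poly_permute[OF p, of ?f] by (simp only: normalized_laplacian_entries[of G vs])
  then show ?thesis by (simp add: normalized_laplacian_spectrum_def ws_def)
qed

text \<open>\<open>nl_eigenvalue G i\<close> is the \<open>i\<close>-th smallest normalized Laplacian eigenvalue, counted from \<open>i = 1\<close>.\<close>

definition nl_eigenvalue :: "'a pair_pre_digraph \<Rightarrow> nat \<Rightarrow> real" where
  "nl_eigenvalue G i = sorted_list_of_multiset (normalized_laplacian_spectrum G) ! (i - 1)"


section \<open>The expressions occurring in the spectrum of the NNS join\<close>

text \<open>
  \<open>d\<close> stands for an eigenvalue of the first graph; the two values belonging to the sign
  \<open>\<mp>\<close> are obtained for \<open>s = -1\<close> and \<open>s = 1\<close>.
\<close>

definition nns_value :: "real \<Rightarrow> real \<Rightarrow> real \<Rightarrow> real \<Rightarrow> real \<Rightarrow> real" where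
  "nns_value n1 n2 r1 d s =
     1 + 2 * (1 + r1 - r1 * d)^2 /
       (r1 * (1 - d) * (n1 - r1 - 1)
        + s * sqrt ((n1 - r1 - 1) *
            (r1^2 * (1 - d)^2 * (n1 - r1 - 1) + 4 * (1 + r1 - r1 * d)^2 * (n1 + n2 - 1))))"

text \<open>The polynomial on the left-hand side of the cubic equation, lowest coefficient first.\<close>

definition nns_cubic :: "real \<Rightarrow> real \<Rightarrow> real \<Rightarrow> real \<Rightarrow> real poly" where
  "nns_cubic n1 n2 r1 r2 =
     [: 0,
        2 * n1^2 + 2 * n1 * n2 - 2 * n1 - r1 * n1 + r2 * n2,
        - (3 * n1^2 + 3 * n1 * n2 - 3 * n1 - r1 * n1
            + 2 * r2 * n1 + 2 * r2 * n2 - 2 * r2 - r1 * r2),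
        n1^2 + n1 * n2 - n1 + r2 * n1 + r2 * n2 - r2 :]"

end

theory Submission
  imports Defs "Jordan_Normal_Form.Schur_Decomposition"
begin

text \<open>
  List the vertices of the NNS join as \<open>V(G\<^sub>1)\<close>, \<open>V(G\<^sub>2)\<close>, copies of \<open>V(G\<^sub>1)\<close>. In \<open>x I - L\<close> the block
  belonging to \<open>V(G\<^sub>2)\<close> and the copies is block diagonal, and since the off-diagonal blocks are
  multiples of the all-ones matrix \<open>J\<close> and of \<open>B = J - I - A\<close>, with \<open>A\<close> the adjacency matrix of \<open>G\<^sub>1\<close>,
  its Schur complement is a quadratic polynomial in \<open>A\<close> plus a multiple of \<open>J\<close>. By regularity, the
  determinant of such a matrix is one factor for the all-ones vector (giving the cubic) times one
  factor for each further eigenvalue of \<open>A\<close> (giving the quadratics). The eigenvalue \<open>-1\<close> of \<open>A\<close>,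
  i.e. \<open>1 + 1 / r\<^sub>1\<close> of the Laplacian, annihilates the coupling \<open>I + A\<close>; all nontrivial eigenvalues
  are equal to it iff \<open>G\<^sub>1\<close> is complete, and then the copies are isolated vertices.
\<close>

section \<open>Determinants of matrices with constant row sums\<close>

text \<open>A nonzero real polynomial has only finitely many roots. Identities of characteristic
  polynomials may therefore be checked pointwise after dividing by quantities that vanish at
  finitely many points.\<close>

lemma poly_eq_cofinite:
  fixes p q :: "real poly"
  assumes "finite F" "\<And>x. x \<notin> F \<Longrightarrow> poly p x = poly q x"
  shows "p = q"
proof (rule ccontr)
  assume "p \<noteq> q"
  then have "finite {x. poly (p - q) x = 0}" by (intro poly_roots_finite) auto
  moreover have "- F \<subseteq> {x. poly (p - q) x = 0}" using assms(2) by auto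
  ultimately have "finite (- F)" by (rule rev_finite_subset)
  with assms(1) show False using infinite_UNIV_char_0[where 'a = real] by simp
qed

text \<open>Multiplying on the right by a unipotent block matrix clears the lower left block.
  Writing that block as \<open>D * X\<close> makes \<open>A - B * X\<close> the Schur complement
  without forming an inverse of \<open>D\<close>.\<close>

lemma det_schur_complement:
  fixes A :: "real mat"
  assumes A: "A \<in> carrier_mat n n" and B: "B \<in> carrier_mat n m"
    and X: "X \<in> carrier_mat m n" and D: "D \<in> carrier_mat m m"
  shows "det (four_block_mat A B (D * X) D) = det (A - B * X) * det D"
proof -
  have eq: "four_block_mat A B (D * X) D * four_block_mat (1\<^sub>m n) (0\<^sub>m n m) (- X) (1\<^sub>m m)
      = four_block_mat (A - B * X) B (0\<^sub>m m n) D"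
    (is "?M * ?E = ?R")
  proof -
    have "A * 1\<^sub>m n + B * (- X) = A - B * X"
      by (rule eq_matI) (use A B X in auto)
    moreover have "D * X * 1\<^sub>m n + D * (- X) = 0\<^sub>m m n"
      by (rule eq_matI) (use D X in auto)
    moreover have "A * 0\<^sub>m n m + B * 1\<^sub>m m = B" "D * X * 0\<^sub>m n m + D * 1\<^sub>m m = D"
      using A B D X by auto
    ultimately show ?thesis
      by (subst mult_four_block_mat[of _ n n _ m _ m _ _ n _ m]) (use A B D X in auto)
  qed
  have "det ?E = 1"
    by (subst det_four_block_mat_upper_right_zero[of _ n _ m]) (use X in auto)
  moreover have "?M \<in> carrier_mat (n + m) (n + m)" "?E \<in> carrier_mat (n + m) (n + m)"
    using A B D X by auto
  ultimately have "det ?M = det ?R" using det_mult[of ?M "n + m" ?E] eq by simp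
  also have "\<dots> = det (A - B * X) * det D"
    by (rule det_four_block_mat_lower_left_zero) (use A B D X in auto)
  finally show ?thesis .
qed

text \<open>If all row sums of \<open>M\<close> agree, \<open>M\<close> maps the all-ones vector to
  a multiple of itself. This is then the matrix of the map induced on the quotient by that vector,
  in the classes of the unit vectors with index at least 1.\<close>

definition deflate :: "real mat \<Rightarrow> real mat" where
  "deflate M = mat (dim_row M - 1) (dim_row M - 1) (\<lambda>(i, j). M $$ (Suc i, Suc j) - M $$ (0, Suc j))"

lemma deflate_carrier [simp]: "M \<in> carrier_mat (Suc k) (Suc k) \<Longrightarrow> deflate M \<in> carrier_mat k k"
  by (auto simp: deflate_def)

text \<open>Adding all columns to the first one and then subtracting the first row from the others.\<close>

lemma det_deflate:
  assumes M: "M \<in> carrier_mat (Suc k) (Suc k)"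
    and rs: "\<And>i. i < Suc k \<Longrightarrow> (\<Sum>j<Suc k. M $$ (i, j)) = s"
  shows "det M = s * det (deflate M)"
proof -
  define R where "R = mat 1 k (\<lambda>(i, j). M $$ (0, Suc j))"
  let ?l = "mat k 1 (\<lambda>_. 1 :: real)"
  \<comment> \<open>The columns of \<open>P\<close> are the all-ones vector and the unit vectors
    with positive index. In this basis \<open>M\<close> becomes the block triangular matrix
    \<open>T\<close>.\<close>
  define P where "P = four_block_mat (1\<^sub>m 1) (0\<^sub>m 1 k) ?l (1\<^sub>m k)"
  define T where "T = four_block_mat (mat 1 1 (\<lambda>_. s)) R (0\<^sub>m k 1) (deflate M)"
  have Pc: "P \<in> carrier_mat (Suc k) (Suc k)"
    unfolding P_def by (intro carrier_matI) simp_all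
  have Tc: "T \<in> carrier_mat (Suc k) (Suc k)" using M unfolding T_def
    by (intro carrier_matI) (simp_all add: deflate_def)
  have P0: "P $$ (i, 0) = 1" "P $$ (i, Suc j) = (if i = Suc j then 1 else 0)"
    if "i < Suc k" "j < k" for i j
    using that by (auto simp: P_def)
  have P00: "P $$ (i, 0) = 1" if "i < Suc k" for i
    using that by (auto simp: P_def)
  have PT: "P * T = four_block_mat (mat 1 1 (\<lambda>_. s)) R (mat k 1 (\<lambda>_. s)) (mat k k (\<lambda>(i,j). M $$ (Suc i, Suc j)))"
  proof -
    have "?l * mat 1 1 (\<lambda>_. s) + 1\<^sub>m k * 0\<^sub>m k 1 = mat k 1 (\<lambda>_. s)"
      by (rule eq_matI) (auto simp: scalar_prod_def)
    moreover have "?l * R + 1\<^sub>m k * deflate M = mat k k (\<lambda>(i, j). M $$ (Suc i, Suc j))"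
      by (rule eq_matI) (use M in \<open>auto simp: scalar_prod_def R_def deflate_def\<close>)
    moreover have "1\<^sub>m 1 * R + 0\<^sub>m 1 k * deflate M = R"
      by (rule eq_matI) (use M in \<open>auto simp: R_def deflate_def\<close>)
    moreover have "1\<^sub>m 1 * mat 1 1 (\<lambda>_. s) + 0\<^sub>m 1 k * 0\<^sub>m k 1 = mat 1 1 (\<lambda>_. s)"
      by simp
    ultimately show ?thesis
      unfolding P_def T_def
      by (subst mult_four_block_mat[of _ 1 1 _ k _ k _ _ 1 _ k]) (use M in \<open>auto simp: R_def\<close>)
  qed
  have "M * P = P * T"
  proof (rule eq_matI)
    fix i j assume ij: "i < dim_row (P * T)" "j < dim_col (P * T)"
    then have ij: "i < Suc k" "j < Suc k" using Pc Tc by auto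
    have *: "(M * P) $$ (i, j) = (\<Sum>l<Suc k. M $$ (i, l) * P $$ (l, j))"
      using ij M Pc by (simp add: scalar_prod_def atLeast0LessThan)
    show "(M * P) $$ (i, j) = (P * T) $$ (i, j)"
    proof (cases j)
      case 0
      then show ?thesis unfolding * unfolding PT using ij rs[of i] by (simp add: P00 del: sum.lessThan_Suc)
    next
      case (Suc j')
      then have "(M * P) $$ (i, j) = (\<Sum>l<Suc k. if l = j then M $$ (i, l) else 0)"
        unfolding * using ij by (intro sum.cong) (auto simp: P0)
      also have "\<dots> = M $$ (i, j)" using ij by (simp add: sum.delta del: sum.lessThan_Suc)
      finally show ?thesis unfolding PT using ij Suc by (auto simp: R_def)
    qed
  qed (use M Pc Tc in auto)
  moreover have "det P = 1"
    unfolding P_def by (subst det_four_block_mat_upper_right_zero[of _ 1 _ k]) auto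
  moreover have "det T = s * det (deflate M)"
    unfolding T_def
    by (subst det_four_block_mat_lower_left_zero[of _ 1 _ k]) (use M in \<open>auto simp: R_def det_single\<close>)
  ultimately show ?thesis using det_mult[OF M Pc] det_mult[OF Pc Tc] by simp
qed

text \<open>The difference of two rows of \<open>A\<close> sums to zero. Subtracting the constant
  \<open>B $$ (0, Suc j)\<close> from a column of \<open>B\<close> thus changes no product, and it
  removes the term with index 0.\<close>

lemma deflate_mult:
  assumes A: "A \<in> carrier_mat (Suc k) (Suc k)" and B: "B \<in> carrier_mat (Suc k) (Suc k)"
    and rs: "\<And>i. i < Suc k \<Longrightarrow> (\<Sum>j<Suc k. A $$ (i, j)) = r"
  shows "deflate (A * B) = deflate A * deflate B"
proof (rule eq_matI)
  fix i j assume "i < dim_row (deflate A * deflate B)" "j < dim_col (deflate A * deflate B)"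
  then have ij: "i < k" "j < k" using A B by (auto simp: deflate_def)
  define a where "a l = A $$ (Suc i, l) - A $$ (0, l)" for l
  have a0: "(\<Sum>l<Suc k. a l) = 0"
    using rs[of "Suc i"] rs[of 0] ij by (simp add: a_def sum_subtractf del: sum.lessThan_Suc)
  have "deflate (A * B) $$ (i, j) = (\<Sum>l<Suc k. a l * B $$ (l, Suc j))"
    using ij A B
    by (simp add: deflate_def scalar_prod_def a_def atLeast0LessThan left_diff_distrib sum_subtractf
        del: sum.lessThan_Suc)
  also have "\<dots> = (\<Sum>l<Suc k. a l * (B $$ (l, Suc j) - B $$ (0, Suc j)))"
    using a0 by (simp add: right_diff_distrib sum_subtractf sum_distrib_right[symmetric] del: sum.lessThan_Suc)
  also have "\<dots> = (\<Sum>l<k. a (Suc l) * (B $$ (Suc l, Suc j) - B $$ (0, Suc j)))"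
    by (subst sum.lessThan_Suc_shift) simp
  also have "\<dots> = (deflate A * deflate B) $$ (i, j)"
    using ij A B by (simp add: deflate_def scalar_prod_def a_def atLeast0LessThan)
  finally show "deflate (A * B) $$ (i, j) = (deflate A * deflate B) $$ (i, j)" .
qed (use A B in \<open>auto simp: deflate_def\<close>)

text \<open>A deflated adjacency matrix is in general not symmetric, so \<open>B\<close> is
  triangularised by a Schur decomposition rather than diagonalised. The quadratic expression in the
  triangular matrix has the values at the eigenvalues on its diagonal.\<close>

lemma det_quadratic:
  fixes B :: "real mat"
  assumes B: "B \<in> carrier_mat k k" and cp: "char_poly B = (\<Prod>e\<leftarrow>es. [:- e, 1:])"
  shows "det (a \<cdot>\<^sub>m (B * B) + b \<cdot>\<^sub>m B + c \<cdot>\<^sub>m 1\<^sub>m k) = (\<Prod>e\<leftarrow>es. a * e\<^sup>2 + b * e + c)"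
proof -
  obtain T P Q where "schur_decomposition B es = (T, P, Q)" by (cases "schur_decomposition B es") auto
  from schur_decomposition[OF B cp this]
  have sim: "similar_mat_wit B T P Q" and ut: "upper_triangular T" and dg: "diag_mat T = es" by auto
  note S = similar_mat_witD2[OF B sim]
  note c = S(5-7)
  let ?M = "a \<cdot>\<^sub>m (T * T) + b \<cdot>\<^sub>m T + c \<cdot>\<^sub>m 1\<^sub>m k"
  have Mc: "?M \<in> carrier_mat k k" using c by auto
  have BB: "B * B = P * (T * T) * Q"
    using similar_mat_wit_pow_id[OF sim, of 2] c B by (simp add: numeral_2_eq_2 carrier_matD)
  have "P * ?M * Q = a \<cdot>\<^sub>m (P * (T * T) * Q) + b \<cdot>\<^sub>m (P * T * Q) + c \<cdot>\<^sub>m (P * 1\<^sub>m k * Q)"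
    using c by (simp add: mult_add_distrib_mat[of _ k k _ k] add_mult_distrib_mat[of _ k k _ _ k]
        mult_smult_distrib[of _ k k _ k] mult_smult_assoc_mat[of _ k k _ k])
  also have "\<dots> = a \<cdot>\<^sub>m (B * B) + b \<cdot>\<^sub>m B + c \<cdot>\<^sub>m 1\<^sub>m k"
    unfolding BB using S c by simp
  finally have "similar_mat_wit (a \<cdot>\<^sub>m (B * B) + b \<cdot>\<^sub>m B + c \<cdot>\<^sub>m 1\<^sub>m k) ?M P Q"
    by (intro similar_mat_witI[of _ _ k]) (use S c B in auto)
  then have "det (a \<cdot>\<^sub>m (B * B) + b \<cdot>\<^sub>m B + c \<cdot>\<^sub>m 1\<^sub>m k) = det ?M"
    by (intro det_similar) (auto simp: similar_mat_def)
  \<comment> \<open>A nonzero term \<open>T $$ (i, l) * T $$ (l, j)\<close> requires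
    \<open>i \<le> l \<le> j\<close>, so with \<open>j \<le> i\<close> only \<open>l = i = j\<close>
    remains.\<close>
  also have TT: "(T * T) $$ (i, j) = (if i = j then (T $$ (i, i))\<^sup>2 else 0)" if "j \<le> i" "i < k" for i j
  proof -
    have "(T * T) $$ (i, j) = (\<Sum>l = 0..<k. T $$ (i, l) * T $$ (l, j))"
      using that c by (simp add: scalar_prod_def)
    also have "\<dots> = (\<Sum>l = 0..<k. if l = i then (if i = j then (T $$ (i, i))\<^sup>2 else 0) else 0)"
    proof (rule sum.cong)
      fix l assume "l \<in> {0..<k}"
      then show "T $$ (i, l) * T $$ (l, j) = (if l = i then (if i = j then (T $$ (i, i))\<^sup>2 else 0) else 0)"
        using upper_triangularD[OF ut, of l i] upper_triangularD[OF ut, of j l] that c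
        by (cases l i rule: linorder_cases) (auto simp: power2_eq_square)
    qed simp
    also have "\<dots> = (if i = j then (T $$ (i, i))\<^sup>2 else 0)" using that by simp
    finally show ?thesis .
  qed
  have "upper_triangular ?M"
    by (rule upper_triangularI) (use c upper_triangularD[OF ut] TT in auto)
  then have "det ?M = prod_list (diag_mat ?M)" using Mc by (rule det_upper_triangular)
  also have "diag_mat ?M = map (\<lambda>e. a * e\<^sup>2 + b * e + c) es"
  proof -
    have "row T i \<bullet> col T i = (T $$ (i, i))\<^sup>2" if "i < k" for i
      using TT[of i i] that c by simp
    then show ?thesis unfolding dg[symmetric] using c by (auto simp: diag_mat_def)
  qed
  finally show ?thesis .
qed

text \<open>The trace is invariant under cyclic exchange of factors, hence under the similarity to a
  triangular matrix. It serves to recover the degree of a regular graph from its nontrivial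
  eigenvalues.\<close>

lemma trace_eq_sum_list:
  fixes B :: "real mat"
  assumes B: "B \<in> carrier_mat k k" and cp: "char_poly B = (\<Prod>e\<leftarrow>es. [:- e, 1:])"
  shows "(\<Sum>i<k. B $$ (i, i)) = sum_list es"
proof -
  obtain T P Q where "schur_decomposition B es = (T, P, Q)" by (cases "schur_decomposition B es") auto
  from schur_decomposition[OF B cp this]
  have sim: "similar_mat_wit B T P Q" and dg: "diag_mat T = es" by auto
  note S = similar_mat_witD2[OF B sim]
  note c = S(5-7)
  have tr: "(\<Sum>i<k. (X * Y) $$ (i, i)) = (\<Sum>i<k. (Y * X) $$ (i, i))"
    if "X \<in> carrier_mat k k" "Y \<in> carrier_mat k k" for X Y :: "real mat"
    using that by (simp add: scalar_prod_def atLeast0LessThan, subst sum.swap) (simp add: mult.commute)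
  have "(\<Sum>i<k. B $$ (i, i)) = (\<Sum>i<k. (Q * (P * T)) $$ (i, i))"
    unfolding S(3) using c by (intro tr) auto
  also have "Q * (P * T) = T"
    using S c by (simp flip: assoc_mult_mat[of Q k k P k T k])
  also have "(\<Sum>i<k. T $$ (i, i)) = sum_list es"
    unfolding dg[symmetric] using c
    by (simp add: diag_mat_def sum_list_sum_nth atLeast0LessThan)
  finally show ?thesis .
qed

text \<open>The matrix has constant row sums, which give the first factor. Deflation erases the
  multiple of the all-ones matrix, because its rows are equal, and leaves the same quadratic
  expression in \<open>deflate A\<close>.\<close>

lemma det_regular_quadratic:
  fixes A :: "real mat"
  assumes A: "A \<in> carrier_mat (Suc k) (Suc k)"
    and rs: "\<And>i. i < Suc k \<Longrightarrow> (\<Sum>j<Suc k. A $$ (i, j)) = r"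
    and cp: "char_poly (deflate A) = (\<Prod>e\<leftarrow>es. [:- e, 1:])"
  shows "det (a \<cdot>\<^sub>m (A * A) + b \<cdot>\<^sub>m A + c \<cdot>\<^sub>m 1\<^sub>m (Suc k) + mat (Suc k) (Suc k) (\<lambda>_. d))
    = (a * r\<^sup>2 + b * r + c + d * Suc k) * (\<Prod>e\<leftarrow>es. a * e\<^sup>2 + b * e + c)"
    (is "det ?M = _")
proof -
  have Mc: "?M \<in> carrier_mat (Suc k) (Suc k)" using A by auto
  have AA: "(\<Sum>j<Suc k. (A * A) $$ (i, j)) = r\<^sup>2" if "i < Suc k" for i
  proof -
    have "(\<Sum>j<Suc k. (A * A) $$ (i, j)) = (\<Sum>j<Suc k. \<Sum>l<Suc k. A $$ (i, l) * A $$ (l, j))"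
      using A that by (simp add: scalar_prod_def atLeast0LessThan del: sum.lessThan_Suc)
    also have "\<dots> = (\<Sum>l<Suc k. A $$ (i, l) * (\<Sum>j<Suc k. A $$ (l, j)))"
      unfolding sum_distrib_left by (rule sum.swap)
    also have "\<dots> = (\<Sum>l<Suc k. A $$ (i, l) * r)"
      using rs by (intro sum.cong) auto
    also have "\<dots> = r\<^sup>2"
      using rs[OF that] by (simp add: power2_eq_square del: sum.lessThan_Suc flip: sum_distrib_right)
    finally show ?thesis .
  qed
  have "(\<Sum>j<Suc k. ?M $$ (i, j)) = a * r\<^sup>2 + b * r + c + d * Suc k" if i: "i < Suc k" for i
  proof -
    have "(\<Sum>j<Suc k. ?M $$ (i, j)) = (\<Sum>j<Suc k. a * (A * A) $$ (i, j) + b * A $$ (i, j) + (if j = i then c else 0) + d)"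
      using A i by (intro sum.cong) auto
    also have "\<dots> = a * r\<^sup>2 + b * r + c + d * Suc k"
      using AA[OF i] rs[OF i] i
      by (simp add: sum.distrib sum_distrib_left[symmetric] del: sum.lessThan_Suc)
    finally show ?thesis .
  qed
  then have "det ?M = (a * r\<^sup>2 + b * r + c + d * Suc k) * det (deflate ?M)"
    by (rule det_deflate[OF Mc])
  also have "deflate ?M = a \<cdot>\<^sub>m deflate (A * A) + b \<cdot>\<^sub>m deflate A + c \<cdot>\<^sub>m 1\<^sub>m k"
    by (rule eq_matI) (use A in \<open>auto simp: deflate_def algebra_simps\<close>)
  also have "deflate (A * A) = deflate A * deflate A" by (rule deflate_mult[OF A A rs])
  also have "det (a \<cdot>\<^sub>m (deflate A * deflate A) + b \<cdot>\<^sub>m deflate A + c \<cdot>\<^sub>m 1\<^sub>m k)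
      = (\<Prod>e\<leftarrow>es. a * e\<^sup>2 + b * e + c)"
    by (rule det_quadratic[OF _ cp]) (use A in simp)
  finally show ?thesis .
qed

section \<open>Spectra of regular graphs\<close>

lemma proots_prod_linear: "proots (\<Prod>e\<leftarrow>es. [:- e, 1:]) = mset (es :: real list)"
proof (induction es)
  case (Cons e es)
  have "[:- e, 1:] * (\<Prod>e\<leftarrow>es. [:- e, 1:]) \<noteq> 0"
    by (auto simp: prod_list_zero_iff simp del: mult_pCons_left)
  with Cons show ?case by (simp add: proots_mult del: mult_pCons_left)
qed simp

lemma poly_char_poly:
  fixes A :: "real mat"
  assumes "A \<in> carrier_mat n n"
  shows "poly (char_poly A) x = det (x \<cdot>\<^sub>m 1\<^sub>m n - A)"
proof -
  have "- char_matrix A x = x \<cdot>\<^sub>m 1\<^sub>m n - A"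
    by (rule eq_matI) (use assms in \<open>auto simp: char_matrix_def\<close>)
  with char_poly_matrix[OF assms, of x] show ?thesis by simp
qed

text \<open>The polynomial splits over the complex numbers, and every root is real by the usual
  argument for Hermitian forms. The factorisation descends because the embedding of the reals is
  injective on polynomials.\<close>

lemma symmetric_char_poly_splits:
  fixes A :: "real mat"
  assumes A: "A \<in> carrier_mat n n"
    and sym: "\<And>i j. i < n \<Longrightarrow> j < n \<Longrightarrow> A $$ (i, j) = A $$ (j, i)"
  obtains as where "char_poly A = (\<Prod>a\<leftarrow>as. [:- a, 1:])" "length as = n"
proof -
  interpret h: map_poly_inj_comm_ring_hom "of_real :: real \<Rightarrow> complex" ..
  let ?C = "map_mat complex_of_real A"
  have C: "?C \<in> carrier_mat n n" using A by auto
  obtain cs where cs: "char_poly ?C = (\<Prod>c\<leftarrow>cs. [:- c, 1:])" "length cs = n"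
    using char_poly_factorized[OF C] by auto
  have real: "complex_of_real (Re c) = c" if "c \<in> set cs" for c
  proof -
    have "poly (char_poly ?C) c = 0"
      unfolding cs(1) poly_prod_list using that by (auto simp: prod_list_zero_iff o_def image_iff intro!: bexI[of _ c])
    then have "eigenvalue ?C c" using eigenvalue_root_char_poly[OF C] by simp
    then obtain v where v: "v \<in> carrier_vec n" "v \<noteq> 0\<^sub>v n" and ev: "?C *\<^sub>v v = c \<cdot>\<^sub>v v"
      using A by (auto simp: eigenvalue_def eigenvector_def)
    have row: "(\<Sum>j<n. of_real (A $$ (i, j)) * v $ j) = c * v $ i" if "i < n" for i
      using arg_cong[OF ev, of "\<lambda>w. w $ i"] that A v by (simp add: scalar_prod_def atLeast0LessThan)
    \<comment> \<open>The Hermitian form of \<open>A\<close> at the eigenvector \<open>v\<close>: it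
      equals \<open>c\<close> times the squared norm \<open>w\<close>, and symmetry makes it equal
      to its own conjugate.\<close>
    define q where "q = (\<Sum>i<n. cnj (v $ i) * (\<Sum>j<n. of_real (A $$ (i, j)) * v $ j))"
    define w where "w = (\<Sum>i<n. (cmod (v $ i))\<^sup>2)"
    have "q = (\<Sum>i<n. cnj (v $ i) * (c * v $ i))"
      unfolding q_def using row by (intro sum.cong) auto
    also have "\<dots> = c * of_real w"
      by (simp add: w_def sum_distrib_left complex_norm_square mult_ac del: of_real_power)
    finally have q: "q = c * of_real w" .
    have "cnj q = (\<Sum>i<n. \<Sum>j<n. v $ i * (of_real (A $$ (i, j)) * cnj (v $ j)))"
      by (simp add: q_def sum_distrib_left)
    also have "\<dots> = (\<Sum>j<n. \<Sum>i<n. v $ i * (of_real (A $$ (i, j)) * cnj (v $ j)))"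
      by (rule sum.swap)
    also have "\<dots> = q"
      unfolding q_def sum_distrib_left using sym by (intro sum.cong refl) (simp add: mult_ac)
    finally have "cnj c * of_real w = c * of_real w" using q by simp
    moreover have "w \<noteq> 0"
    proof
      assume "w = 0"
      then have "\<forall>i<n. v $ i = 0" by (auto simp: w_def sum_nonneg_eq_0_iff)
      then show False using v by auto
    qed
    ultimately have "cnj c = c" by simp
    then show ?thesis using Reals_cnj_iff complex_is_Real_iff
      by (metis of_real_Re)
  qed
  have "map_poly complex_of_real (char_poly A) = char_poly ?C"
    by (simp add: of_real_hom.char_poly_hom[OF A])
  also have "\<dots> = (\<Prod>c\<leftarrow>cs. map_poly complex_of_real [:- Re c, 1:])"
    unfolding cs(1) using real by (intro arg_cong[where f = prod_list] map_cong) auto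
  also have "\<dots> = map_poly complex_of_real (\<Prod>a\<leftarrow>map Re cs. [:- a, 1:])"
    by (simp add: h.hom_prod_list o_def)
  finally have "char_poly A = (\<Prod>a\<leftarrow>map Re cs. [:- a, 1:])"
    using h.injectivity by blast
  then show ?thesis using cs(2) that by (metis length_map)
qed

text \<open>Compare both sides of the eigenvector equation at an index where the entry of
  \<open>v\<close> has largest modulus. The bound is what makes the Laplacian eigenvalues of a
  regular graph nonnegative.\<close>

lemma regular_eigenvalue_bound:
  fixes A :: "real mat"
  assumes A: "A \<in> carrier_mat n n"
    and nonneg: "\<And>i j. i < n \<Longrightarrow> j < n \<Longrightarrow> 0 \<le> A $$ (i, j)"
    and rs: "\<And>i. i < n \<Longrightarrow> (\<Sum>j<n. A $$ (i, j)) = r"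
    and root: "poly (char_poly A) e = 0"
  shows "\<bar>e\<bar> \<le> r"
proof -
  from root have "eigenvalue A e" using eigenvalue_root_char_poly[OF A] by simp
  then obtain v where v: "v \<in> carrier_vec n" "v \<noteq> 0\<^sub>v n" and ev: "A *\<^sub>v v = e \<cdot>\<^sub>v v"
    using A by (auto simp: eigenvalue_def eigenvector_def)
  then obtain l where l: "l < n" "v $ l \<noteq> 0" by (metis eq_vecI carrier_vecD index_zero_vec)
  define i where "i = arg_max_on (\<lambda>i. \<bar>v $ i\<bar>) {..<n}"
  have i: "i < n" "\<And>j. j < n \<Longrightarrow> \<bar>v $ j\<bar> \<le> \<bar>v $ i\<bar>"
  proof -
    have "Max ((\<lambda>i. \<bar>v $ i\<bar>) ` {..<n}) \<in> (\<lambda>i. \<bar>v $ i\<bar>) ` {..<n}"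
      using l by (intro Max_in) auto
    then have "\<exists>i. is_arg_max (\<lambda>i. \<bar>v $ i\<bar>) (\<lambda>i. i \<in> {..<n}) i"
      by (auto simp: is_arg_max_linorder intro!: Max_ge)
         (metis Max_ge finite_imageI finite_lessThan image_eqI lessThan_iff)
    then have "is_arg_max (\<lambda>i. \<bar>v $ i\<bar>) (\<lambda>i. i \<in> {..<n}) i"
      unfolding i_def arg_max_on_def arg_max_def by (rule someI_ex)
    then show "i < n" "\<And>j. j < n \<Longrightarrow> \<bar>v $ j\<bar> \<le> \<bar>v $ i\<bar>"
      by (auto simp: is_arg_max_linorder)
  qed
  have "e * v $ i = (\<Sum>j<n. A $$ (i, j) * v $ j)"
    using arg_cong[OF ev, of "\<lambda>w. w $ i"] i A v by (simp add: scalar_prod_def atLeast0LessThan)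
  then have "\<bar>e\<bar> * \<bar>v $ i\<bar> = \<bar>\<Sum>j<n. A $$ (i, j) * v $ j\<bar>" by (metis abs_mult)
  also have "\<dots> \<le> (\<Sum>j<n. \<bar>A $$ (i, j) * v $ j\<bar>)" by (rule sum_abs)
  also have "\<dots> \<le> (\<Sum>j<n. A $$ (i, j) * \<bar>v $ i\<bar>)"
    using i nonneg by (intro sum_mono) (auto simp: abs_mult intro!: mult_left_mono)
  also have "\<dots> = r * \<bar>v $ i\<bar>" using rs[OF i(1)] by (simp flip: sum_distrib_right)
  finally show ?thesis using i(2)[OF l(1)] l(2) by (auto simp: mult_le_cancel_right)
qed

section \<open>From Laplacian to adjacency eigenvalues of regular graphs\<close>

lemma graph_degree_eq_card: "graph_degree G v = card {w. (v, w) \<in> parcs G}"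
proof -
  have "out_arcs (with_proj G) v = Pair v ` {w. (v, w) \<in> parcs G}"
    by (auto simp: out_arcs_def)
  then show ?thesis by (simp add: out_degree_def card_image inj_on_def)
qed

lemma adjacency_mat_row_sum:
  assumes "pair_graph G" and vs: "distinct vs" "set vs = pverts G" and "i < length vs"
  shows "(\<Sum>j<length vs. adjacency_mat G vs $$ (i, j)) = graph_degree G (vs ! i)"
proof -
  interpret pair_graph G by fact
  have "(\<Sum>j<length vs. adjacency_mat G vs $$ (i, j))
      = (\<Sum>j<length vs. if (vs ! i, vs ! j) \<in> parcs G then 1 else 0)"
    using assms(4) by (intro sum.cong) (auto simp: adjacency_mat_def)
  also have "\<dots> = card {j \<in> {..<length vs}. (vs ! i, vs ! j) \<in> parcs G}"
    by (simp add: sum.If_cases Int_def)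
  also have "\<dots> = card ((!) vs ` {j \<in> {..<length vs}. (vs ! i, vs ! j) \<in> parcs G})"
    using vs(1) by (subst card_image) (auto simp: inj_on_def nth_eq_iff_index_eq)
  also have "(!) vs ` {j \<in> {..<length vs}. (vs ! i, vs ! j) \<in> parcs G} = {w. (vs ! i, w) \<in> parcs G}"
  proof (intro equalityI subsetI)
    fix w assume "w \<in> {w. (vs ! i, w) \<in> parcs G}"
    moreover from this have "w \<in> set vs" using vs(2) in_arcsD2 by auto
    ultimately show "w \<in> (!) vs ` {j \<in> {..<length vs}. (vs ! i, vs ! j) \<in> parcs G}"
      by (auto simp: in_set_conv_nth)
  qed auto
  finally show ?thesis by (simp add: graph_degree_eq_card)
qed

text \<open>\<open>x I - A\<close> has constant row sums \<open>x - r\<close>, and it deflates to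
  \<open>x I - deflate A\<close>.\<close>

lemma char_poly_deflate:
  assumes A: "A \<in> carrier_mat (Suc k) (Suc k)"
    and rs: "\<And>i. i < Suc k \<Longrightarrow> (\<Sum>j<Suc k. A $$ (i, j)) = r"
  shows "char_poly A = [:- r, 1:] * char_poly (deflate A)"
proof (rule poly_eq_cofinite[of "{}"])
  fix x
  have "(\<Sum>j<Suc k. (x \<cdot>\<^sub>m 1\<^sub>m (Suc k) - A) $$ (i, j)) = x - r" if i: "i < Suc k" for i
  proof -
    have "(\<Sum>j<Suc k. (x \<cdot>\<^sub>m 1\<^sub>m (Suc k) - A) $$ (i, j)) = (\<Sum>j<Suc k. (if j = i then x else 0) - A $$ (i, j))"
      using A i by (intro sum.cong) auto
    also have "\<dots> = x - r" using rs[OF i] i by (simp add: sum_subtractf del: sum.lessThan_Suc)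
    finally show ?thesis .
  qed
  then have "det (x \<cdot>\<^sub>m 1\<^sub>m (Suc k) - A) = (x - r) * det (deflate (x \<cdot>\<^sub>m 1\<^sub>m (Suc k) - A))"
    using A by (intro det_deflate[of _ k]) auto
  also have "deflate (x \<cdot>\<^sub>m 1\<^sub>m (Suc k) - A) = x \<cdot>\<^sub>m 1\<^sub>m k - deflate A"
    by (rule eq_matI) (use A in \<open>auto simp: deflate_def\<close>)
  finally show "poly (char_poly A) x = poly ([:- r, 1:] * char_poly (deflate A)) x"
    using A by (simp add: poly_char_poly[of _ "Suc k"] poly_char_poly[of _ k] algebra_simps)
qed simp

text \<open>For degree \<open>r > 0\<close> the Laplacian is \<open>I - A / r\<close>, so an
  adjacency eigenvalue \<open>e\<close> corresponds to \<open>1 - e / r\<close>, and the all-ones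
  vector accounts for the smallest eigenvalue 0. The indices from 2 on enumerate the rest. For
  \<open>r = 0\<close> all eigenvalues involved are 0.\<close>

lemma regular_graph_spectrum:
  fixes G :: "'a pair_pre_digraph"
  assumes G: "pair_graph G" and vs: "distinct vs" "set vs = pverts G" "length vs = Suc k"
    and reg: "regular_graph G r"
  shows "char_poly (deflate (adjacency_mat G vs)) =
    (\<Prod>e\<leftarrow>map (\<lambda>i. r * (1 - nl_eigenvalue G i)) [2..<Suc (Suc k)]. [:- e, 1:])"
proof -
  interpret pair_graph G by fact
  define A where "A = adjacency_mat G vs"
  \<comment> \<open>The common diagonal entry of the Laplacian, which by convention is 0 if all
    vertices are isolated.\<close>
  define d :: real where "d = (if r = 0 then 0 else 1)"
  have A: "A \<in> carrier_mat (Suc k) (Suc k)" by (simp add: A_def adjacency_mat_def vs)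
  have deg: "graph_degree G (vs ! i) = r" if "i < Suc k" for i
    using reg that vs nth_mem[of i vs] by (simp add: regular_graph_def)
  have rs: "(\<Sum>j<Suc k. A $$ (i, j)) = r" if "i < Suc k" for i
    using adjacency_mat_row_sum[OF G vs(1,2), of i] that deg[OF that] by (simp add: A_def vs(3) del: sum.lessThan_Suc)
  obtain as where as: "char_poly A = (\<Prod>a\<leftarrow>as. [:- a, 1:])" "length as = Suc k"
  proof (rule symmetric_char_poly_splits[OF A])
    show "A $$ (i, j) = A $$ (j, i)" if "i < Suc k" "j < Suc k" for i j
      using that arcs_symmetric by (auto simp: A_def adjacency_mat_def vs)
  qed
  have split: "char_poly A = [:- real r, 1:] * char_poly (deflate A)"
    by (rule char_poly_deflate[OF A rs])
  have "poly (char_poly A) r = 0" unfolding split by simp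
  then have r: "real r \<in> set as" unfolding as by (auto simp: poly_prod_list prod_list_zero_iff)
  \<comment> \<open>Only the copy of \<open>r\<close> belonging to the all-ones vector is removed;
    any further copies of \<open>r\<close> stay in \<open>es\<close>.\<close>
  define es where "es = remove1 (real r) as"
  have mas: "mset as = add_mset (real r) (mset es)" using r by (simp add: es_def)
  then have "char_poly A = [:- real r, 1:] * (\<Prod>e\<leftarrow>es. [:- e, 1:])"
    unfolding as by (simp flip: prod_mset_prod_list)
  then have es: "char_poly (deflate A) = (\<Prod>e\<leftarrow>es. [:- e, 1:])"
    using split by (simp only: mult_cancel_left) simp
  have bound: "\<bar>e\<bar> \<le> r" if "e \<in> set es" for e
  proof (rule regular_eigenvalue_bound[OF A _ rs])
    show "poly (char_poly A) e = 0"
      unfolding split es using that by (auto simp: poly_prod_list prod_list_zero_iff)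
  qed (auto simp: A_def adjacency_mat_def vs)
  have len: "length es = k" using as(2) r by (simp add: es_def length_remove1)
  let ?L = "normalized_laplacian G vs"
  have L: "?L = d \<cdot>\<^sub>m 1\<^sub>m (Suc k) - (1 / r) \<cdot>\<^sub>m A"
    unfolding normalized_laplacian_entries A_def adjacency_mat_def d_def
    by (rule eq_matI) (auto simp: vs deg)
  have Lc: "?L \<in> carrier_mat (Suc k) (Suc k)" unfolding L using A by auto
  have "char_poly ?L = [:0, 1:] * (\<Prod>e\<leftarrow>map (\<lambda>e. d - e / r) es. [:- e, 1:])"
  proof (rule poly_eq_cofinite[of "{}"])
    fix x
    have "x \<cdot>\<^sub>m 1\<^sub>m (Suc k) - ?L
      = 0 \<cdot>\<^sub>m (A * A) + (1 / r) \<cdot>\<^sub>m A + (x - d) \<cdot>\<^sub>m 1\<^sub>m (Suc k) + mat (Suc k) (Suc k) (\<lambda>_. 0)"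
      unfolding L by (rule eq_matI) (use A in auto)
    moreover note det_regular_quadratic[OF A _ es, of r 0 "1 / r" "x - d" 0]
    ultimately have "poly (char_poly ?L) x = (r / r + (x - d)) * (\<Prod>e\<leftarrow>es. e / r + (x - d))"
      using rs by (simp add: poly_char_poly[OF Lc] del: sum.lessThan_Suc)
    \<comment> \<open>Division by zero gives 0, so \<open>r / r\<close> agrees with \<open>d\<close>
      for \<open>r = 0\<close> too.\<close>
    also have "real r / r + (x - d) = x" by (simp add: d_def)
    finally show "poly (char_poly ?L) x = poly ([:0, 1:] * (\<Prod>e\<leftarrow>map (\<lambda>e. d - e / r) es. [:- e, 1:])) x"
      by (simp add: poly_prod_list o_def algebra_simps)
  qed simp
  then have "normalized_laplacian_spectrum G = proots ([:0, 1:] * (\<Prod>e\<leftarrow>map (\<lambda>e. d - e / r) es. [:- e, 1:]))"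
    using normalized_laplacian_spectrum_eq[OF vs(1,2)] by simp
  also have "\<dots> = proots [:0, 1:] + proots (\<Prod>e\<leftarrow>map (\<lambda>e. d - e / r) es. [:- e, 1:])"
    by (rule proots_mult) (auto simp: prod_list_zero_iff)
  also have "proots (\<Prod>e\<leftarrow>map (\<lambda>e. d - e / r) es. [:- e, 1:]) = mset (map (\<lambda>e. d - e / r) es)"
    using proots_prod_linear[of "map (\<lambda>e. d - e / r) es"] by simp
  finally have "normalized_laplacian_spectrum G = add_mset 0 (mset (map (\<lambda>e. d - e / r) es))"
    by simp
  then have "sorted_list_of_multiset (normalized_laplacian_spectrum G)
      = insort 0 (sort (map (\<lambda>e. d - e / r) es))"
    by (simp only: sorted_list_of_multiset_insert sorted_list_of_multiset_mset)
  also have "\<forall>x\<in>set (map (\<lambda>e. d - e / r) es). 0 \<le> x"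
    using bound by (force simp: d_def field_simps)
  then have "insort 0 (sort (map (\<lambda>e. d - e / r) es)) = 0 # sort (map (\<lambda>e. d - e / r) es)"
    by (intro insort_is_Cons) simp
  finally have sl: "sorted_list_of_multiset (normalized_laplacian_spectrum G)
      = 0 # sort (map (\<lambda>e. d - e / r) es)" .
  \<comment> \<open>\<open>nl_eigenvalue\<close> counts from 1 and the head of the sorted list is
    the eigenvalue 0, so index 2 meets the first entry of the sorted tail.\<close>
  have "map (nl_eigenvalue G) [2..<Suc (Suc k)] = sort (map (\<lambda>e. d - e / r) es)"
  proof (rule nth_equalityI)
    fix i assume "i < length (map (nl_eigenvalue G) [2..<Suc (Suc k)])"
    then show "map (nl_eigenvalue G) [2..<Suc (Suc k)] ! i = sort (map (\<lambda>e. d - e / r) es) ! i"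
      by (simp add: nl_eigenvalue_def sl del: upt_Suc)
  qed (simp add: len del: upt_Suc)
  then have "mset (map (nl_eigenvalue G) [2..<Suc (Suc k)]) = mset (map (\<lambda>e. d - e / r) es)" by (metis mset_sort)
  then have "image_mset (\<lambda>x. r * (1 - x)) (mset (map (nl_eigenvalue G) [2..<Suc (Suc k)]))
     = image_mset (\<lambda>x. r * (1 - x)) (mset (map (\<lambda>e. d - e / r) es))" by simp
  \<comment> \<open>The map undoes \<open>e \<mapsto> d - e / r\<close>; for \<open>r = 0\<close>
    the bound forces \<open>e = 0\<close>, and both sides are 0.\<close>
  also have "\<dots> = image_mset (\<lambda>e. e) (mset es)"
    unfolding mset_map image_mset.compositionality
    by (rule image_mset_cong) (use bound in \<open>force simp: d_def field_simps\<close>)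
  finally have "mset (map (\<lambda>i. r * (1 - nl_eigenvalue G i)) [2..<Suc (Suc k)]) = mset es"
    by (simp add: image_mset.compositionality o_def del: upt_Suc)
  then have "(\<Prod>e\<in>#mset (map (\<lambda>i. r * (1 - nl_eigenvalue G i)) [2..<Suc (Suc k)]). [:- e, 1:])
      = (\<Prod>e\<in>#mset es. [:- e, 1:])" by simp
  then show ?thesis using es unfolding A_def
    by (simp only: prod_mset_prod_list mset_map[symmetric])
qed

section \<open>The characteristic polynomial of the NNS join\<close>

lemma parcs_nns_join:
  "(Inl (Inl u), Inl (Inl v)) \<in> parcs (nns_join G H) \<longleftrightarrow> (u, v) \<in> parcs G"
  "(Inl (Inl u), Inl (Inr w)) \<in> parcs (nns_join G H) \<longleftrightarrow> u \<in> pverts G \<and> w \<in> pverts H"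
  "(Inl (Inr w), Inl (Inl u)) \<in> parcs (nns_join G H) \<longleftrightarrow> u \<in> pverts G \<and> w \<in> pverts H"
  "(Inl (Inr w), Inl (Inr w')) \<in> parcs (nns_join G H) \<longleftrightarrow> (w, w') \<in> parcs H"
  "(Inl (Inl v), Inr u) \<in> parcs (nns_join G H)
    \<longleftrightarrow> u \<in> pverts G \<and> v \<in> pverts G \<and> u \<noteq> v \<and> (u, v) \<notin> parcs G"
  "(Inr u, Inl (Inl v)) \<in> parcs (nns_join G H)
    \<longleftrightarrow> u \<in> pverts G \<and> v \<in> pverts G \<and> u \<noteq> v \<and> (u, v) \<notin> parcs G"
  "(Inl (Inr w), Inr u) \<notin> parcs (nns_join G H)"
  "(Inr u, Inl (Inr w)) \<notin> parcs (nns_join G H)"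
  "(Inr u, Inr v) \<notin> parcs (nns_join G H)"
  by (auto simp: nns_join_def graph_join_def)

text \<open>Count the complement of the closed neighbourhood of \<open>u\<close>, which has
  \<open>r + 1\<close> elements.\<close>

lemma card_non_neighbours:
  assumes "pair_graph G" and "regular_graph G r" and u: "u \<in> pverts G"
  shows "r + 1 \<le> card (pverts G)"
    and "card {v \<in> pverts G. v \<noteq> u \<and> (u, v) \<notin> parcs G} = card (pverts G) - 1 - r"
proof -
  interpret pair_graph G by fact
  let ?N = "{w. (u, w) \<in> parcs G}"
  have N: "card ?N = r" using assms by (simp add: regular_graph_def graph_degree_eq_card)
  have sub: "insert u ?N \<subseteq> pverts G" using u in_arcsD2 by auto
  have fin: "finite (insert u ?N)" using sub pair_finite_verts by (rule finite_subset)
  have "card (insert u ?N) = r + 1" using N fin no_loops' by (subst card_insert_disjoint) auto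
  moreover have "{v \<in> pverts G. v \<noteq> u \<and> (u, v) \<notin> parcs G} = pverts G - insert u ?N" by auto
  ultimately show "r + 1 \<le> card (pverts G)"
    "card {v \<in> pverts G. v \<noteq> u \<and> (u, v) \<notin> parcs G} = card (pverts G) - 1 - r"
    using card_mono[OF pair_finite_verts sub] card_Diff_subset[OF fin sub] by auto
qed

text \<open>For a vertex of \<open>G\<close>, its \<open>r\<close> neighbours in \<open>G\<close>
  and the \<open>card (pverts G) - 1 - r\<close> copies of its non-neighbours add up to a number
  independent of \<open>r\<close>.\<close>

lemma nns_join_degrees:
  assumes G: "pair_graph G" "regular_graph G r" and H: "pair_graph H" "regular_graph H s"
  shows "u \<in> pverts G \<Longrightarrow>
      graph_degree (nns_join G H) (Inl (Inl u)) = card (pverts G) + card (pverts H) - 1"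
    and "w \<in> pverts H \<Longrightarrow> graph_degree (nns_join G H) (Inl (Inr w)) = card (pverts G) + s"
    and "u \<in> pverts G \<Longrightarrow> graph_degree (nns_join G H) (Inr u) = card (pverts G) - 1 - r"
proof -
  interpret G: pair_graph G by fact
  interpret H: pair_graph H by fact
  have eqU: "{x. (Inl (Inl u), x) \<in> parcs (nns_join G H)}
      = Inl ` (Inl ` {v. (u, v) \<in> parcs G} \<union> Inr ` pverts H)
        \<union> Inr ` {v \<in> pverts G. v \<noteq> u \<and> (u, v) \<notin> parcs G}" if "u \<in> pverts G" for u
    using that G.arcs_symmetric by (auto simp: nns_join_def graph_join_def)
  have eqW: "{x. (Inl (Inr w), x) \<in> parcs (nns_join G H)}
      = Inl ` (Inl ` pverts G \<union> Inr ` {v. (w, v) \<in> parcs H})" if "w \<in> pverts H" for w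
    using that by (auto simp: nns_join_def graph_join_def)
  have eqU': "{x. (Inr u, x) \<in> parcs (nns_join G H)}
      = Inl ` Inl ` {v \<in> pverts G. v \<noteq> u \<and> (u, v) \<notin> parcs G}" if "u \<in> pverts G" for u
    using that by (auto simp: nns_join_def)
  have finG: "finite {v. (u, v) \<in> parcs G}" for u
    using G.in_arcsD2 by (intro finite_subset[OF _ G.pair_finite_verts]) auto
  have finH: "finite {v. (w, v) \<in> parcs H}" for w
    using H.in_arcsD2 by (intro finite_subset[OF _ H.pair_finite_verts]) auto
  have regG: "card {v. (u, v) \<in> parcs G} = r" if "u \<in> pverts G" for u
    using G that by (simp add: regular_graph_def graph_degree_eq_card)
  have regH: "card {v. (w, v) \<in> parcs H} = s" if "w \<in> pverts H" for w
    using H that by (simp add: regular_graph_def graph_degree_eq_card)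
  note nn = card_non_neighbours[OF G]
  show "graph_degree (nns_join G H) (Inl (Inl u)) = card (pverts G) + card (pverts H) - 1"
    if u: "u \<in> pverts G"
    unfolding graph_degree_eq_card eqU[OF u]
    apply (subst card_Un_disjoint)
    using finG H.pair_finite_verts G.pair_finite_verts apply auto[3]
    apply (subst card_image, simp add: inj_on_def)
    apply (subst card_image, simp add: inj_on_def)
    apply (subst card_Un_disjoint)
    using finG H.pair_finite_verts apply auto[3]
    using nn[OF u] regG[OF u] by (simp add: card_image inj_on_def)
  show "graph_degree (nns_join G H) (Inl (Inr w)) = card (pverts G) + s" if w: "w \<in> pverts H"
    unfolding graph_degree_eq_card eqW[OF w]
    apply (subst card_image, simp add: inj_on_def)
    apply (subst card_Un_disjoint)
    using finH G.pair_finite_verts apply auto[3]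
    using regH[OF w] by (simp add: card_image inj_on_def)
  show "graph_degree (nns_join G H) (Inr u) = card (pverts G) - 1 - r" if u: "u \<in> pverts G"
    unfolding graph_degree_eq_card eqU'[OF u]
    using nn(2)[OF u] by (simp add: card_image inj_on_def)
qed

text \<open>\<open>B = J - I - A\<close> is the adjacency matrix of the complement, where
  \<open>J\<close> is the all-ones matrix. Expand the square with \<open>J A = A J = r J\<close> and
  \<open>J J = n J\<close>.\<close>

lemma complement_mat_square:
  fixes A :: "real mat"
  assumes A: "A \<in> carrier_mat n n"
    and rs: "\<And>i. i < n \<Longrightarrow> (\<Sum>j<n. A $$ (i, j)) = r"
    and sym: "\<And>i j. i < n \<Longrightarrow> j < n \<Longrightarrow> A $$ (i, j) = A $$ (j, i)"
  defines "B \<equiv> mat n n (\<lambda>(i, j). 1 - (if i = j then 1 else 0) - A $$ (i, j))"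
  shows "B * B = A * A + 2 \<cdot>\<^sub>m A + 1\<^sub>m n + mat n n (\<lambda>_. real n - 2 - 2 * real r)"
proof (rule eq_matI)
  fix i j assume "i < dim_row (A * A + 2 \<cdot>\<^sub>m A + 1\<^sub>m n + mat n n (\<lambda>_. real n - 2 - 2 * real r))"
    "j < dim_col (A * A + 2 \<cdot>\<^sub>m A + 1\<^sub>m n + mat n n (\<lambda>_. real n - 2 - 2 * real r))"
  then have ij: "i < n" "j < n" by auto
  \<comment> \<open>Symmetry turns the row sums into column sums, that is, it gives
    \<open>J A = r J\<close>.\<close>
  have cs: "(\<Sum>l<n. A $$ (l, j)) = r"
    using rs[OF ij(2)] sym ij by simp
  have "(B * B) $$ (i, j)
    = (\<Sum>l<n. (1 - (if i = l then 1 else 0) - A $$ (i, l)) * (1 - (if l = j then 1 else 0) - A $$ (l, j)))"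
    using ij by (simp add: B_def scalar_prod_def atLeast0LessThan)
  also have "\<dots> = (\<Sum>l<n. 1 - (if l = j then 1 else 0) - A $$ (l, j)
      - (if l = i then 1 - (if i = j then 1 else 0) - A $$ (i, j) else 0)
      - A $$ (i, l) + (if l = j then A $$ (i, j) else 0) + A $$ (i, l) * A $$ (l, j))"
    by (intro sum.cong refl) (auto simp: algebra_simps)
  also have "\<dots> = real n - 1 - r - (1 - (if i = j then 1 else 0) - A $$ (i, j)) - r + A $$ (i, j)
      + (\<Sum>l<n. A $$ (i, l) * A $$ (l, j))"
    using ij cs rs[OF ij(1)] by (simp add: sum.distrib sum_subtractf)
  also have "\<dots> = (A * A + 2 \<cdot>\<^sub>m A + 1\<^sub>m n + mat n n (\<lambda>_. real n - 2 - 2 * real r)) $$ (i, j)"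
    using ij A by (auto simp: scalar_prod_def atLeast0LessThan)
  finally show "(B * B) $$ (i, j) = \<dots>" .
qed (simp_all add: B_def)

text \<open>
  The case \<open>m = 0\<close> is that of isolated copies: they contribute \<open>x\<close> instead of \<open>x - 1\<close> on the diagonal,
  and division by zero makes the terms that come from coupling with the copies vanish.
\<close>

lemma char_poly_nns_join:
  fixes G :: "'a pair_pre_digraph" and H :: "'b pair_pre_digraph" and x :: real
  assumes G: "pair_graph G" "regular_graph G r" and us: "distinct us" "set us = pverts G" "length us = n"
    and H: "pair_graph H" "regular_graph H s" and ws: "distinct ws" "set ws = pverts H" "length ws = n'"
    and n: "1 \<le> n" "1 \<le> n'"
    and es: "char_poly (deflate (adjacency_mat G us)) = (\<Prod>e\<leftarrow>es. [:- e, 1:])"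
    and fs: "char_poly (deflate (adjacency_mat H ws)) = (\<Prod>e\<leftarrow>fs. [:- e, 1:])"
  defines "N \<equiv> real n + real n' - 1" and "D \<equiv> real n + real s" and "m \<equiv> real n - 1 - real r"
  defines "y \<equiv> x - 1" and "z \<equiv> (if m = 0 then x else x - 1)"
  assumes z: "z \<noteq> 0" and Dy: "y + s / D \<noteq> 0"
  shows "poly (char_poly (normalized_laplacian (nns_join G H)
        (map (\<lambda>u. Inl (Inl u)) us @ map (\<lambda>w. Inl (Inr w)) ws @ map Inr us))) x
    = z ^ n * ((y + s / D) * (\<Prod>f\<leftarrow>fs. y + f / D))
      * ((y + r / N - m\<^sup>2 / (N * m * z) - n * n' / (N * D * (y + s / D)))
         * (\<Prod>e\<leftarrow>es. y + e / N - (1 + e)\<^sup>2 / (N * m * z)))"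
proof -
  interpret G: pair_graph G by (rule G)
  interpret H: pair_graph H by (rule H)
  obtain k where k: "n = Suc k" using n(1) by (cases n) auto
  obtain k' where k': "n' = Suc k'" using n(2) by (cases n') auto
  define A where "A = adjacency_mat G us"
  define A' where "A' = adjacency_mat H ws"
  have A: "A \<in> carrier_mat n n" by (simp add: A_def adjacency_mat_def us)
  have A': "A' \<in> carrier_mat n' n'" by (simp add: A'_def adjacency_mat_def ws)
  have Aij: "A $$ (i, j) = (if (us ! i, us ! j) \<in> parcs G then 1 else 0)" if "i < n" "j < n" for i j
    using that by (simp add: A_def adjacency_mat_def us)
  have A'ij: "A' $$ (i, j) = (if (ws ! i, ws ! j) \<in> parcs H then 1 else 0)" if "i < n'" "j < n'" for i j
    using that by (simp add: A'_def adjacency_mat_def ws)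
  have usi: "us ! i \<in> pverts G" if "i < n" for i using us that nth_mem[of i us] by simp
  have wsi: "ws ! i \<in> pverts H" if "i < n'" for i using ws that nth_mem[of i ws] by simp
  have cG: "card (pverts G) = n" using us distinct_card by metis
  have cH: "card (pverts H) = n'" using ws distinct_card by metis
  have rsA: "(\<Sum>j<n. A $$ (i, j)) = r" if "i < n" for i
    using adjacency_mat_row_sum[OF G(1) us(1,2), of i] G(2) usi[OF that] that
    by (simp add: A_def us(3) regular_graph_def)
  have rsA': "(\<Sum>j<n'. A' $$ (i, j)) = s" if "i < n'" for i
    using adjacency_mat_row_sum[OF H(1) ws(1,2), of i] H(2) wsi[OF that] that
    by (simp add: A'_def ws(3) regular_graph_def)
  have symA: "A $$ (i, j) = A $$ (j, i)" if "i < n" "j < n" for i j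
    using that G.arcs_symmetric by (auto simp: Aij)
  have rn: "r + 1 \<le> n" using card_non_neighbours(1)[OF G usi[of 0]] n cG by simp
  \<comment> \<open>\<open>N\<close>, \<open>D\<close> and \<open>m\<close> are the degrees in the
    join of the vertices of \<open>G\<close>, the vertices of \<open>H\<close> and the
    copies.\<close>
  have N: "N > 0" and D: "D > 0" using rn n by (auto simp: N_def D_def)
  have Nn: "real (n + n' - 1) = N" using n by (simp add: N_def)
  have mn: "real (n - 1 - r) = m" using rn by (simp add: m_def)
  have m0: "m = 0 \<longleftrightarrow> n - 1 - r = 0" unfolding mn[symmetric] by simp
  define vs :: "(('a + 'b) + 'a) list"
    where "vs = map (\<lambda>u. Inl (Inl u)) us @ map (\<lambda>w. Inl (Inr w)) ws @ map Inr us"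
  \<comment> \<open>\<open>c\<close> and \<open>c'\<close> are the weights of the edges from
    \<open>V(G)\<close> to \<open>V(H)\<close> and to the copies. If the copies are isolated,
    \<open>m = 0\<close> and division by zero gives \<open>c' = 0\<close>.\<close>
  define c where "c = 1 / sqrt N * (1 / sqrt D)"
  define c' where "c' = 1 / sqrt N * (1 / sqrt m)"
  define B where "B = mat n n (\<lambda>(i, j). 1 - (if i = j then 1 else 0) - A $$ (i, j))"
  have B: "B \<in> carrier_mat n n" by (simp add: B_def)
  define X where "X = y \<cdot>\<^sub>m 1\<^sub>m n + (1 / N) \<cdot>\<^sub>m A"
  \<comment> \<open>The blocks with no rows only serve to put two matrices side by side;
    \<open>Z\<close> stacks two matrices in the same way.\<close>
  define Y where "Y = four_block_mat (mat n n' (\<lambda>_. c)) (c' \<cdot>\<^sub>m B) (0\<^sub>m 0 n') (0\<^sub>m 0 n)"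
  define E where "E = y \<cdot>\<^sub>m 1\<^sub>m n' + (1 / D) \<cdot>\<^sub>m A'"
  define F where "F = four_block_mat E (0\<^sub>m n' n) (0\<^sub>m n n') (z \<cdot>\<^sub>m 1\<^sub>m n)"
  \<comment> \<open>This solves \<open>F * Z =\<close> transpose of \<open>Y\<close> explicitly:
    \<open>E\<close> multiplies an all-ones column by its row sum \<open>y + s / D\<close>, and the
    other diagonal block of \<open>F\<close> is \<open>z\<close> times the identity.\<close>
  define Z where "Z = four_block_mat (mat n' n (\<lambda>_. c / (y + s / D))) (0\<^sub>m n' 0) ((c' / z) \<cdot>\<^sub>m B) (0\<^sub>m n 0)"
  have X: "X \<in> carrier_mat n n" and E: "E \<in> carrier_mat n' n'" using A A' by (auto simp: X_def E_def)
  have Y: "Y \<in> carrier_mat n (n' + n)" using B by (auto simp: Y_def)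
  have F: "F \<in> carrier_mat (n' + n) (n' + n)" using E by (auto simp: F_def)
  have Z: "Z \<in> carrier_mat (n' + n) n" using B by (auto simp: Z_def)
  have FZ: "F * Z = four_block_mat (mat n' n (\<lambda>_. c)) (0\<^sub>m n' 0) (c' \<cdot>\<^sub>m B) (0\<^sub>m n 0)"
  proof -
    have "E * mat n' n (\<lambda>_. c / (y + s / D)) + 0\<^sub>m n' n * ((c' / z) \<cdot>\<^sub>m B) = mat n' n (\<lambda>_. c)"
    proof (rule eq_matI)
      fix i j assume "i < dim_row (mat n' n (\<lambda>_. c))" "j < dim_col (mat n' n (\<lambda>_. c))"
      then have ij: "i < n'" "j < n" by auto
      have "(\<Sum>l<n'. E $$ (i, l)) = (\<Sum>l<n'. (if l = i then y else 0) + A' $$ (i, l) / D)"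
        using ij A' by (intro sum.cong) (auto simp: E_def)
      also have "\<dots> = y + s / D"
        using ij rsA'[OF ij(1)] by (simp add: sum.distrib flip: sum_divide_distrib)
      finally have "(\<Sum>l<n'. E $$ (i, l) * (c / (y + s / D))) = c"
        unfolding sum_distrib_right[symmetric] using Dy by simp
      then show "(E * mat n' n (\<lambda>_. c / (y + s / D)) + 0\<^sub>m n' n * ((c' / z) \<cdot>\<^sub>m B)) $$ (i, j) = mat n' n (\<lambda>_. c) $$ (i, j)"
        using ij E B by (simp add: scalar_prod_def atLeast0LessThan)
    qed (use E B in auto)
    moreover have "0\<^sub>m n n' * mat n' n (\<lambda>_. c / (y + s / D)) + (z \<cdot>\<^sub>m 1\<^sub>m n) * ((c' / z) \<cdot>\<^sub>m B) = c' \<cdot>\<^sub>m B"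
      using B z by (intro eq_matI) (auto simp: mult_smult_assoc_mat[of _ n n _ n] mult_smult_distrib[of _ n n _ n])
    moreover have "E * 0\<^sub>m n' 0 + 0\<^sub>m n' n * 0\<^sub>m n 0 = 0\<^sub>m n' 0"
      "0\<^sub>m n n' * 0\<^sub>m n' 0 + (z \<cdot>\<^sub>m 1\<^sub>m n) * 0\<^sub>m n 0 = 0\<^sub>m n 0"
      by (intro eq_matI; use E in auto)+
    ultimately show ?thesis
      unfolding F_def Z_def
      by (subst mult_four_block_mat[of _ n' n' _ n _ n _ _ n _ 0]) (use E B in auto)
  qed
  \<comment> \<open>\<open>p\<close> and \<open>q\<close> will be the coefficients of
    \<open>B * B\<close> and of the all-ones matrix in \<open>Y * Z\<close>; for
    \<open>m = 0\<close> the coefficient \<open>p\<close> is 0.\<close>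
  define p where "p = 1 / (N * m * z)"
  define q where "q = n' / (N * D * (y + s / D))"
  have c2: "c * c = 1 / (N * D)" using N D by (simp add: c_def flip: real_sqrt_mult)
  have c'2: "c' * c' = 1 / (N * m)" using N rn by (simp add: c'_def m_def flip: real_sqrt_mult)
  have YZ: "Y * Z = mat n n (\<lambda>_. q) + p \<cdot>\<^sub>m (B * B)"
  proof -
    have 1: "mat n n' (\<lambda>_. c) * mat n' n (\<lambda>_. c / (y + s / D)) = mat n n (\<lambda>_. q)"
      using c2 by (intro eq_matI) (auto simp: scalar_prod_def q_def field_simps)
    have 2: "(c' \<cdot>\<^sub>m B) * ((c' / z) \<cdot>\<^sub>m B) = p \<cdot>\<^sub>m (B * B)"
    proof -
      have "c' * (c' / z) = p" using c'2 by (simp add: p_def)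
      moreover have "(c' \<cdot>\<^sub>m B) * ((c' / z) \<cdot>\<^sub>m B) = (c' * (c' / z)) \<cdot>\<^sub>m (B * B)"
        using B by (intro eq_matI) (auto simp: mult_smult_assoc_mat[of _ n n _ n] mult_smult_distrib[of _ n n _ n])
      ultimately show ?thesis by simp
    qed
    show ?thesis
      unfolding Y_def Z_def
      apply (subst mult_four_block_mat[of _ n n' _ n _ 0 _ _ n _ 0])
      using B apply auto[8]
      unfolding 1 2 by (rule eq_matI) (use B in auto)
  qed
  have lap: "x \<cdot>\<^sub>m 1\<^sub>m (n + (n' + n)) - normalized_laplacian (nns_join G H) vs = four_block_mat X Y (F * Z) F"
  proof (rule eq_matI)
    note deg = nns_join_degrees[OF G H]
    fix i j assume "i < dim_row (four_block_mat X Y (F * Z) F)" "j < dim_col (four_block_mat X Y (F * Z) F)"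
    then have ij: "i < n + (n' + n)" "j < n + (n' + n)" using X F by auto
    have len: "length vs = n + (n' + n)" by (simp add: vs_def us ws)
    have idx: "(i < n \<and> vs ! i = Inl (Inl (us ! i)))
      \<or> (\<exists>i'<n'. i = n + i' \<and> vs ! i = Inl (Inr (ws ! i')))
      \<or> (\<exists>i'<n. i = n + (n' + i') \<and> vs ! i = Inr (us ! i'))" if "i < n + (n' + n)" for i
    proof -
      consider "i < n" | "n \<le> i" "i < n + n'" | "n + n' \<le> i" by linarith
      then show ?thesis
      proof cases
        case 2
        then have "i - n < n'" "i = n + (i - n)" "vs ! i = Inl (Inr (ws ! (i - n)))"
          by (auto simp: vs_def nth_append us ws)
        then show ?thesis by blast
      next
        case 3
        then have "i - (n + n') < n" "i = n + (n' + (i - (n + n')))" "vs ! i = Inr (us ! (i - (n + n')))"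
          using that by (auto simp: vs_def nth_append us ws)
        then show ?thesis by blast
      qed (auto simp: vs_def nth_append us)
    qed
    have sq: "sqrt N * sqrt N = N" "sqrt D * sqrt D = D"
      using N D by simp_all
    have pos: "n + n' - Suc 0 \<noteq> 0" "0 < n + n' - Suc 0" "n + s \<noteq> 0" using n Nn N D rn by auto
    have pos': "Suc 0 < n + n'" "\<bar>N\<bar> = N" "N \<noteq> 0" "\<bar>D\<bar> = D" using pos(2) N D by auto
    have nl: "(v, v) \<notin> parcs G" "(w, w) \<notin> parcs H" for v w
      using G.no_loops' H.no_loops' by blast+
    have Dn: "real n + real s = D" by (simp add: D_def)
    have dU: "graph_degree (nns_join G H) (Inl (Inl (us ! i))) = n + n' - 1"
      "graph_degree (nns_join G H) (Inr (us ! i)) = n - 1 - r" if "i < n" for i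
      using deg(1,3)[OF usi[OF that]] cG cH by simp_all
    have dW: "graph_degree (nns_join G H) (Inl (Inr (ws ! i))) = n + s" if "i < n'" for i
      using deg(2)[OF wsi[OF that]] cG by simp
    have us_eq: "us ! i = us ! j \<longleftrightarrow> i = j" if "i < n" "j < n" for i j
      using us that by (simp add: nth_eq_iff_index_eq)
    have us_sym: "(us ! i, us ! j) \<in> parcs G \<longleftrightarrow> (us ! j, us ! i) \<in> parcs G" for i j
      using G.arcs_symmetric by blast
    note [simp] = len dU dW us_eq Nn[simplified] mn[simplified] m0 pos Dn sq parcs_nns_join usi wsi Aij A'ij nl pos'
    show "(x \<cdot>\<^sub>m 1\<^sub>m (n + (n' + n)) - normalized_laplacian (nns_join G H) vs) $$ (i, j)
      = four_block_mat X Y (F * Z) F $$ (i, j)"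
      unfolding FZ unfolding F_def E_def X_def Y_def normalized_laplacian_entries
      using idx[OF ij(1)] idx[OF ij(2)] A A' B
      by (elim disjE exE conjE, simp_all add: B_def c_def c'_def y_def z_def)
         (use n G.arcs_symmetric in auto)
  qed (use X F in \<open>auto simp: normalized_laplacian_entries vs_def us ws\<close>)
  have "poly (char_poly (normalized_laplacian (nns_join G H) vs)) x
      = det (four_block_mat X Y (F * Z) F)"
    unfolding lap[symmetric]
    by (rule poly_char_poly) (auto simp: normalized_laplacian_entries vs_def us ws)
  also have "\<dots> = det (X - Y * Z) * det F"
    by (rule det_schur_complement[OF X Y Z F])
  also have "det F = det E * z ^ n"
    unfolding F_def by (subst det_four_block_mat_lower_left_zero[of _ n' _ n]) (use E in auto)
  also have "det E = (y + s / D) * (\<Prod>f\<leftarrow>fs. y + f / D)"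
  proof -
    have "E = 0 \<cdot>\<^sub>m (A' * A') + (1 / D) \<cdot>\<^sub>m A' + y \<cdot>\<^sub>m 1\<^sub>m n' + mat n' n' (\<lambda>_. 0)"
      unfolding E_def by (rule eq_matI) (use A' in auto)
    also have "det \<dots> = (0 * (real s)\<^sup>2 + 1 / D * s + y + 0 * real n') * (\<Prod>f\<leftarrow>fs. 0 * f\<^sup>2 + 1 / D * f + y)"
      unfolding k' by (rule det_regular_quadratic) (use A' rsA' fs in \<open>auto simp: k' A'_def simp del: sum.lessThan_Suc\<close>)
    finally show ?thesis by (simp add: add.commute)
  qed
  also have "det (X - Y * Z) = (y + r / N - p * m\<^sup>2 - q * n) * (\<Prod>e\<leftarrow>es. y + e / N - p * (1 + e)\<^sup>2)"
  proof -
    have BB: "B * B = A * A + 2 \<cdot>\<^sub>m A + 1\<^sub>m n + mat n n (\<lambda>_. real n - 2 - 2 * real r)"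
      unfolding B_def by (rule complement_mat_square[OF A rsA symA])
    have "X - Y * Z = (- p) \<cdot>\<^sub>m (A * A) + (1 / N - 2 * p) \<cdot>\<^sub>m A + (y - p) \<cdot>\<^sub>m 1\<^sub>m n
        + mat n n (\<lambda>_. - p * (real n - 2 - 2 * real r) - q)"
      unfolding YZ BB X_def by (rule eq_matI) (use A in \<open>auto simp: algebra_simps\<close>)
    also have "det \<dots> = ((- p) * (real r)\<^sup>2 + (1 / N - 2 * p) * r + (y - p) + (- p * (real n - 2 - 2 * real r) - q) * n)
        * (\<Prod>e\<leftarrow>es. (- p) * e\<^sup>2 + (1 / N - 2 * p) * e + (y - p))"
      unfolding k by (rule det_regular_quadratic) (use A rsA es in \<open>auto simp: k A_def simp del: sum.lessThan_Suc\<close>)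
    \<comment> \<open>The terms with \<open>p\<close> collect to
      \<open>(1 + r)\<^sup>2 - 2 n (1 + r) + n\<^sup>2 = m\<^sup>2\<close>. For the other
      eigenvalues only \<open>(1 + e)\<^sup>2\<close> arises, as the all-ones matrix does not
      contribute.\<close>
    also have "(- p) * (real r)\<^sup>2 + (1 / N - 2 * p) * r + (y - p) + (- p * (real n - 2 - 2 * real r) - q) * n
        = y + r / N - p * m\<^sup>2 - q * n"
      by (simp add: m_def power2_eq_square algebra_simps)
    also have "(\<lambda>e. (- p) * e\<^sup>2 + (1 / N - 2 * p) * e + (y - p)) = (\<lambda>e. y + e / N - p * (1 + e)\<^sup>2)"
      by (simp add: fun_eq_iff power2_eq_square algebra_simps)
    finally show ?thesis .
  qed
  finally show ?thesis
    unfolding vs_def p_def q_def by (simp add: mult_ac)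
qed

section \<open>The spectrum of the NNS join\<close>

text \<open>In terms of \<open>x - 1\<close> the quadratic has root sum \<open>- e / N\<close> and
  root product \<open>- (1 + e)\<^sup>2 / (N m)\<close>, with \<open>N = n1 + n2 - 1\<close> and
  \<open>m = n1 - r1 - 1\<close>. The two values have the square root in the denominator, and
  Vieta's formulas are checked for them.\<close>

lemma nns_value_factors:
  assumes m: "n1 - r1 - 1 > 0" and N: "n1 + n2 - 1 > 0" and e: "e = r1 * (1 - d)" "e \<noteq> - 1"
  shows "[:1 - e / (n1 + n2 - 1) - (1 + e)\<^sup>2 / ((n1 + n2 - 1) * (n1 - r1 - 1)), e / (n1 + n2 - 1) - 2, 1:]
    = [:- nns_value n1 n2 r1 d (-1), 1:] * [:- nns_value n1 n2 r1 d 1, 1:]"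
proof -
  define m where "m = n1 - r1 - 1"
  define N where "N = n1 + n2 - 1"
  define c where "c = (1 + e)\<^sup>2"
  define w where "w = sqrt (m * (e\<^sup>2 * m + 4 * c * N))"
  \<comment> \<open>The denominators for the two signs. Their product is a nonzero multiple of
    \<open>(1 + e)\<^sup>2\<close>, so neither vanishes as long as
    \<open>e \<noteq> - 1\<close>.\<close>
  define a b where "a = e * m - w" and "b = e * m + w"
  have pos: "m > 0" "N > 0" using assms by (simp_all add: m_def N_def)
  have c: "c > 0" using e(2) by (simp add: c_def add_eq_0_iff)
  have "w\<^sup>2 = m * (e\<^sup>2 * m + 4 * c * N)"
    unfolding w_def using pos c by (intro real_sqrt_pow2 mult_nonneg_nonneg add_nonneg_nonneg) auto
  then have ab: "a * b = - 4 * m * c * N" by (simp add: a_def b_def power2_eq_square algebra_simps)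
  have ne: "a \<noteq> 0" "b \<noteq> 0" using ab pos c by auto
  have sum: "2 * c / a + 2 * c / b = - e / N"
  proof -
    have "2 * c / a + 2 * c / b = 2 * c * (a + b) / (a * b)" using ne by (simp add: field_simps)
    also have "\<dots> = - e / N" unfolding ab using pos c by (simp add: a_def b_def field_simps)
    finally show ?thesis .
  qed
  have prod: "(2 * c / a) * (2 * c / b) = - c / (N * m)"
  proof -
    have "(2 * c / a) * (2 * c / b) = 4 * c * c / (a * b)" by simp
    also have "\<dots> = - c / (N * m)" unfolding ab using pos c by (simp add: field_simps)
    finally show ?thesis .
  qed
  have k: "1 + r1 - r1 * d = 1 + e" using e(1) by (simp add: algebra_simps)
  have v: "nns_value n1 n2 r1 d (-1) = 1 + 2 * c / a" "nns_value n1 n2 r1 d 1 = 1 + 2 * c / b"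
    unfolding nns_value_def power_mult_distrib[symmetric] e(1)[symmetric] k
    by (simp_all add: a_def b_def w_def c_def m_def N_def)
  have *: "[:- (1 + p), 1:] * [:- (1 + q), 1:] = [:1 + (p + q) + p * q, - (p + q) - 2, 1:]" for p q :: real
    by (simp add: algebra_simps)
  show ?thesis unfolding v * sum prod by (simp add: c_def N_def m_def)
qed

text \<open>For \<open>e = - 1\<close> the constant term in \<open>x - 1\<close> disappears, leaving
  the roots 0 and \<open>1 / (n1 + n2 - 1)\<close> for \<open>x - 1\<close>. This is the degenerate
  case in which a denominator of \<open>nns_value\<close> is zero.\<close>

lemma proots_nns_quadratic:
  assumes "n1 - r1 - 1 > 0" and "n1 + n2 - 1 > 0" and "e = r1 * (1 - d)"
  shows "proots [:1 - e / (n1 + n2 - 1) - (1 + e)\<^sup>2 / ((n1 + n2 - 1) * (n1 - r1 - 1)), e / (n1 + n2 - 1) - 2, 1:]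
    = (if e = - 1 then {#1, 1 + 1 / (n1 + n2 - 1)#}
       else {#nns_value n1 n2 r1 d (-1), nns_value n1 n2 r1 d 1#})"
proof -
  have *: "proots ([:- p, 1:] * [:- q, 1:]) = {#p, q#}" for p q :: real
    by (subst proots_mult) (auto simp del: mult_pCons_left)
  show ?thesis
  proof (cases "e = - 1")
    case True
    have "[:1 - e / (n1 + n2 - 1) - (1 + e)\<^sup>2 / ((n1 + n2 - 1) * (n1 - r1 - 1)), e / (n1 + n2 - 1) - 2, 1:]
      = [:- 1, 1:] * [:- (1 + 1 / (n1 + n2 - 1)), 1:]" by (simp add: True)
    then show ?thesis using True by (simp only: * simp_thms if_True)
  next
    case False
    then show ?thesis unfolding nns_value_factors[OF assms False] * by simp
  qed
qed

text \<open>A complete graph has adjacency matrix \<open>J - I\<close>, which deflates to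
  \<open>- I\<close>. Conversely, the zero diagonal makes the trace of the deflated matrix
  \<open>- r\<close>, while \<open>k\<close> eigenvalues \<open>- 1\<close> give the trace
  \<open>- k\<close>.\<close>

lemma regular_complete_iff:
  assumes G: "pair_graph G" "regular_graph G r" and us: "distinct us" "set us = pverts G" "length us = Suc k"
    and es: "char_poly (deflate (adjacency_mat G us)) = (\<Prod>e\<leftarrow>es. [:- e, 1:])" and len: "length es = k"
  shows "r = k \<longleftrightarrow> (\<forall>e\<in>set es. e = - 1)"
proof -
  interpret pair_graph G by (rule G)
  define A where "A = adjacency_mat G us"
  have A: "A \<in> carrier_mat (Suc k) (Suc k)" by (simp add: A_def adjacency_mat_def us)
  have Aij: "A $$ (i, j) = (if (us ! i, us ! j) \<in> parcs G then 1 else 0)" if "i < Suc k" "j < Suc k" for i j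
    using that by (simp add: A_def adjacency_mat_def us)
  have usi: "us ! i \<in> pverts G" if "i < Suc k" for i using us that nth_mem[of i us] by simp
  have card: "card (pverts G) = Suc k" using us distinct_card by metis
  have diag: "A $$ (i, i) = 0" if "i < Suc k" for i using that no_loops' by (auto simp: Aij)
  have dA: "deflate A \<in> carrier_mat k k" using A by simp
  show ?thesis
  proof
    assume r: "r = k"
    have adj: "(us ! i, us ! j) \<in> parcs G" if "i < Suc k" "j < Suc k" "i \<noteq> j" for i j
    proof -
      have "card {v \<in> pverts G. v \<noteq> us ! i \<and> (us ! i, v) \<notin> parcs G} = 0"
        using card_non_neighbours(2)[OF G usi[OF that(1)]] card r by simp
      then have "{v \<in> pverts G. v \<noteq> us ! i \<and> (us ! i, v) \<notin> parcs G} = {}"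
        using pair_finite_verts by simp
      moreover have "us ! j \<noteq> us ! i" using us that by (simp add: nth_eq_iff_index_eq)
      ultimately show ?thesis using usi[OF that(2)] by blast
    qed
    show "\<forall>e\<in>set es. e = - 1"
    proof
      fix e assume "e \<in> set es"
      then have "poly (char_poly (deflate A)) e = 0"
        using es by (auto simp: A_def poly_prod_list prod_list_zero_iff)
      then have "det (e \<cdot>\<^sub>m 1\<^sub>m k - deflate A) = 0" using poly_char_poly[OF dA] by simp
      also have "e \<cdot>\<^sub>m 1\<^sub>m k - deflate A = (e + 1) \<cdot>\<^sub>m 1\<^sub>m k"
        by (rule eq_matI) (use A adj diag in \<open>auto simp: deflate_def Aij no_loops'\<close>)
      finally show "e = - 1" by (simp add: det_smult)
    qed
  next
    assume "\<forall>e\<in>set es. e = - 1"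
    then have "es = replicate k (- 1)" using len by (metis replicate_length_same)
    then have "(\<Sum>i<k. deflate A $$ (i, i)) = - real k"
      using trace_eq_sum_list[OF dA, of es] es by (simp add: A_def sum_list_replicate)
    moreover have "(\<Sum>i<k. deflate A $$ (i, i)) = - (\<Sum>i<k. A $$ (0, Suc i))"
      using A diag by (simp add: deflate_def sum_negf)
    moreover have "(\<Sum>i<k. A $$ (0, Suc i)) = (\<Sum>j<Suc k. A $$ (0, j))"
      using diag by (subst sum.lessThan_Suc_shift) simp
    moreover have "(\<Sum>j<Suc k. A $$ (0, j)) = real r"
      using adjacency_mat_row_sum[OF G(1) us(1,2), of 0] G(2) usi[of 0]
      by (simp add: A_def us(3) regular_graph_def)
    ultimately show "r = k" by simp
  qed
qed

section \<open>The two cases: first graph complete or not complete\<close>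

text \<open>Here the copies are isolated and contribute \<open>x ^ n\<close>. Each nontrivial
  eigenvalue \<open>- 1\<close> contributes \<open>x - 1 - 1 / N\<close>, and the all-ones vectors
  of both graphs together contribute a quadratic with one more root 0.\<close>

lemma char_poly_nns_join_complete:
  fixes G :: "'a pair_pre_digraph" and H :: "'b pair_pre_digraph"
  assumes G: "pair_graph G" "regular_graph G r" and us: "distinct us" "set us = pverts G" "length us = n"
    and H: "pair_graph H" "regular_graph H s" and ws: "distinct ws" "set ws = pverts H" "length ws = n'"
    and n: "2 \<le> n" "1 \<le> n'"
    and es: "char_poly (deflate (adjacency_mat G us)) = (\<Prod>e\<leftarrow>replicate (n - 1) (- 1). [:- e, 1:])"
    and fs: "char_poly (deflate (adjacency_mat H ws)) = (\<Prod>e\<leftarrow>fs. [:- e, 1:])"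
    and r: "n = Suc r"
  shows "char_poly (normalized_laplacian (nns_join G H)
        (map (\<lambda>u. Inl (Inl u)) us @ map (\<lambda>w. Inl (Inr w)) ws @ map Inr us))
    = (\<Prod>e\<leftarrow>map (\<lambda>f. 1 - f / (real n + real s)) fs @ replicate (n - 1) (1 + 1 / (real n + real n' - 1))
        @ replicate (n + 1) 0
        @ [(real n ^ 2 + 2 * real n * real n' + real s * real n' - real n)
             / ((real s + real n) * (real n + real n' - 1))]. [:- e, 1:])"
proof (rule poly_eq_cofinite[of "{0, 1 - s / (real n + real s)}"])
  \<comment> \<open>The excluded points are those where the isolated copies or the all-ones vector
    of \<open>H\<close> make the eliminated block singular.\<close>
  fix x :: real assume x: "x \<notin> {0, 1 - s / (real n + real s)}"
  define N D where "N = real n + real n' - 1" and "D = real n + real s"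
  define t where "t = (real n ^ 2 + 2 * real n * real n' + real s * real n' - real n) / ((real s + real n) * N)"
  have N: "N > 0" and D: "D > 0" using n by (auto simp: N_def D_def)
  have y: "x - 1 + s / D \<noteq> 0" using x by (auto simp: D_def)
  have "(x - 1 + s / D) * (x - 1 + r / N - n * n' / (N * D * (x - 1 + s / D)))
      = (x - 1 + s / D) * (x - 1 + r / N) - n * n' / (N * D)"
    using y by (simp add: right_diff_distrib)
  also have "\<dots> = x * (x - t)"
  proof -
    have t: "t = (real n ^ 2 + 2 * real n * real n' + real s * real n' - real n) / (D * N)"
      by (simp add: t_def D_def add.commute)
    have "((x - 1 + s / D) * (x - 1 + r / N) - n * n' / (N * D)) * (N * D)
        = ((x - 1) * D + s) * ((x - 1) * N + r) - n * n'"
      using N D by (simp add: field_simps)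
    \<comment> \<open>Since \<open>D - s = n\<close> and \<open>N - r = n'\<close>, the product is
      \<open>(x D - n) (x N - n')\<close>, and subtracting \<open>n n'\<close> cancels its constant
      term.\<close>
    also have "\<dots> = x * (x * (D * N) - (real n ^ 2 + 2 * real n * real n' + real s * real n' - real n))"
      unfolding N_def D_def r by (simp add: power2_eq_square algebra_simps)
    also have "\<dots> = x * (x - t) * (N * D)"
      unfolding t using N D by (simp add: field_simps)
    finally show ?thesis using N D by simp
  qed
  finally have key: "(x - 1 + s / D) * (x - 1 + r / N - n * n' / (N * D * (x - 1 + s / D))) = x * (x - t)" .
  show "poly (char_poly (normalized_laplacian (nns_join G H)
        (map (\<lambda>u. Inl (Inl u)) us @ map (\<lambda>w. Inl (Inr w)) ws @ map Inr us))) x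
    = poly (\<Prod>e\<leftarrow>map (\<lambda>f. 1 - f / (real n + real s)) fs @ replicate (n - 1) (1 + 1 / (real n + real n' - 1))
        @ replicate (n + 1) 0
        @ [(real n ^ 2 + 2 * real n * real n' + real s * real n' - real n)
             / ((real s + real n) * (real n + real n' - 1))]. [:- e, 1:]) x"
  proof -
    have "poly (char_poly (normalized_laplacian (nns_join G H)
        (map (\<lambda>u. Inl (Inl u)) us @ map (\<lambda>w. Inl (Inr w)) ws @ map Inr us))) x
      = x ^ n * ((x - 1 + s / D) * (\<Prod>f\<leftarrow>fs. x - 1 + f / D))
        * ((x - 1 + r / N - n * n' / (N * D * (x - 1 + s / D))) * (x - 1 - 1 / N) ^ (n - 1))"
    proof -
      have m: "real n - 1 - real r = 0" using r by simp
      show ?thesis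
        using char_poly_nns_join[OF G us H ws _ _ es fs, of x] n x y by (simp add: m N_def D_def)
    qed
    also have "\<dots> = (\<Prod>f\<leftarrow>fs. x - 1 + f / D) * (x - 1 - 1 / N) ^ (n - 1) * x ^ n
        * ((x - 1 + s / D) * (x - 1 + r / N - n * n' / (N * D * (x - 1 + s / D))))"
      by (simp only: mult_ac)
    also have "\<dots> = (\<Prod>f\<leftarrow>fs. x - 1 + f / D) * (x - 1 - 1 / N) ^ (n - 1) * x ^ (n + 1) * (x - t)"
      unfolding key by simp
    finally show ?thesis
      by (simp add: poly_prod_list o_def t_def N_def D_def algebra_simps)
  qed
qed simp

text \<open>The copies contribute \<open>(x - 1) ^ n\<close>. One factor \<open>x - 1\<close> clears
  the denominator for each of the \<open>n - 1\<close> nontrivial eigenvalues; the last one, with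
  the all-ones factor of \<open>H\<close>, turns the all-ones factor of \<open>G\<close> into the
  cubic divided by its leading coefficient.\<close>

lemma char_poly_nns_join_noncomplete:
  fixes G :: "'a pair_pre_digraph" and H :: "'b pair_pre_digraph"
  assumes G: "pair_graph G" "regular_graph G r" and us: "distinct us" "set us = pverts G" "length us = n"
    and H: "pair_graph H" "regular_graph H s" and ws: "distinct ws" "set ws = pverts H" "length ws = n'"
    and n: "2 \<le> n" "1 \<le> n'"
    and es: "char_poly (deflate (adjacency_mat G us)) = (\<Prod>e\<leftarrow>es. [:- e, 1:])" and len: "length es = n - 1"
    and fs: "char_poly (deflate (adjacency_mat H ws)) = (\<Prod>e\<leftarrow>fs. [:- e, 1:])"
    and r: "Suc r < n"
  shows "char_poly (normalized_laplacian (nns_join G H)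
        (map (\<lambda>u. Inl (Inl u)) us @ map (\<lambda>w. Inl (Inr w)) ws @ map Inr us))
    = (\<Prod>e\<leftarrow>map (\<lambda>f. 1 - f / (real n + real s)) fs. [:- e, 1:])
      * (\<Prod>e\<leftarrow>es. [:1 - e / (real n + real n' - 1) - (1 + e)\<^sup>2 / ((real n + real n' - 1) * (real n - real r - 1)),
            e / (real n + real n' - 1) - 2, 1:])
      * Polynomial.smult (1 / ((real n + real n' - 1) * (real n + real s))) (nns_cubic n n' r s)"
proof (rule poly_eq_cofinite[of "{1, 1 - s / (real n + real s)}"])
  fix x :: real assume x: "x \<notin> {1, 1 - s / (real n + real s)}"
  define N D m y where "N = real n + real n' - 1" and "D = real n + real s" and "m = real n - 1 - real r" and "y = x - 1"
  have N: "N > 0" and D: "D > 0" and m: "m > 0" using n r by (auto simp: N_def D_def m_def)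
  have y: "y \<noteq> 0" "y + s / D \<noteq> 0" using x by (auto simp: D_def y_def)
  have m': "real n - real r - 1 = m" by (simp add: m_def)
  have quad: "y ^ length es * (\<Prod>e\<leftarrow>es. y + e / N - (1 + e)\<^sup>2 / (N * m * y))
      = (\<Prod>e\<leftarrow>es. y * (y + e / N) - (1 + e)\<^sup>2 / (N * m))"
  proof (induction es)
    case (Cons e es)
    have "y * (y + e / N - (1 + e)\<^sup>2 / (N * m * y)) = y * (y + e / N) - (1 + e)\<^sup>2 / (N * m)"
      using y by (simp add: right_diff_distrib)
    moreover have "y ^ length (e # es) * (\<Prod>e\<leftarrow>e # es. y + e / N - (1 + e)\<^sup>2 / (N * m * y))
        = y * (y + e / N - (1 + e)\<^sup>2 / (N * m * y))
          * (y ^ length es * (\<Prod>e\<leftarrow>es. y + e / N - (1 + e)\<^sup>2 / (N * m * y)))"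
      by (simp add: mult_ac)
    ultimately show ?case unfolding Cons by simp
  qed simp
  have "y * (y + s / D) * (y + r / N - m\<^sup>2 / (N * m * y) - n * n' / (N * D * (y + s / D)))
      = y * (y + s / D) * (y + r / N) - m / N * (y + s / D) - y * (n * n' / (N * D))"
    using y m by (simp add: right_diff_distrib power2_eq_square mult_ac)
  also have "\<dots> = (y * (y * D + s) * (y * N + r) - m * (y * D + s) - y * (n * n')) / (N * D)"
    using N D by (simp add: field_simps)
  also have "y * (y * D + s) * (y * N + r) - m * (y * D + s) - y * (n * n') = poly (nns_cubic n n' r s) x"
    unfolding N_def D_def m_def y_def nns_cubic_def by (simp add: power2_eq_square algebra_simps)
  finally have cubic: "y * (y + s / D) * (y + r / N - m\<^sup>2 / (N * m * y) - n * n' / (N * D * (y + s / D)))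
      = poly (nns_cubic n n' r s) x / (N * D)" .
  have "poly (char_poly (normalized_laplacian (nns_join G H)
        (map (\<lambda>u. Inl (Inl u)) us @ map (\<lambda>w. Inl (Inr w)) ws @ map Inr us))) x
      = y ^ n * ((y + s / D) * (\<Prod>f\<leftarrow>fs. y + f / D))
        * ((y + r / N - m\<^sup>2 / (N * m * y) - n * n' / (N * D * (y + s / D)))
          * (\<Prod>e\<leftarrow>es. y + e / N - (1 + e)\<^sup>2 / (N * m * y)))"
    using char_poly_nns_join[OF G us H ws _ _ es fs, of x] n y m by (simp add: N_def D_def m_def y_def)
  also have "y ^ n = y * y ^ length es" using n len by (cases n) auto
  also have "y * y ^ length es * ((y + s / D) * (\<Prod>f\<leftarrow>fs. y + f / D))
        * ((y + r / N - m\<^sup>2 / (N * m * y) - n * n' / (N * D * (y + s / D)))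
          * (\<Prod>e\<leftarrow>es. y + e / N - (1 + e)\<^sup>2 / (N * m * y)))
      = (\<Prod>f\<leftarrow>fs. y + f / D) * (y ^ length es * (\<Prod>e\<leftarrow>es. y + e / N - (1 + e)\<^sup>2 / (N * m * y)))
        * (y * (y + s / D) * (y + r / N - m\<^sup>2 / (N * m * y) - n * n' / (N * D * (y + s / D))))"
    by (simp only: mult_ac)
  also have "\<dots> = (\<Prod>f\<leftarrow>fs. y + f / D) * (\<Prod>e\<leftarrow>es. y * (y + e / N) - (1 + e)\<^sup>2 / (N * m))
        * (poly (nns_cubic n n' r s) x / (N * D))"
    unfolding quad cubic ..
  also have "(\<Prod>f\<leftarrow>fs. y + f / D) = poly (\<Prod>e\<leftarrow>map (\<lambda>f. 1 - f / D) fs. [:- e, 1:]) x"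
    by (simp add: poly_prod_list o_def y_def algebra_simps)
  also have "(\<Prod>e\<leftarrow>es. y * (y + e / N) - (1 + e)\<^sup>2 / (N * m))
      = poly (\<Prod>e\<leftarrow>es. [:1 - e / N - (1 + e)\<^sup>2 / (N * m), e / N - 2, 1:]) x"
  proof -
    have "y * (y + e / N) - (1 + e)\<^sup>2 / (N * m)
        = poly [:1 - e / N - (1 + e)\<^sup>2 / (N * m), e / N - 2, 1:] x" for e
      by (simp add: y_def algebra_simps diff_divide_distrib)
    then show ?thesis by (simp only: poly_prod_list list.map_comp o_def)
  qed
  finally show "poly (char_poly (normalized_laplacian (nns_join G H)
        (map (\<lambda>u. Inl (Inl u)) us @ map (\<lambda>w. Inl (Inr w)) ws @ map Inr us))) x
    = poly ((\<Prod>e\<leftarrow>map (\<lambda>f. 1 - f / (real n + real s)) fs. [:- e, 1:])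
      * (\<Prod>e\<leftarrow>es. [:1 - e / (real n + real n' - 1) - (1 + e)\<^sup>2 / ((real n + real n' - 1) * (real n - real r - 1)),
            e / (real n + real n' - 1) - 2, 1:])
      * Polynomial.smult (1 / ((real n + real n' - 1) * (real n + real s))) (nns_cubic n n' r s)) x"
    unfolding N_def[symmetric] D_def[symmetric] m'
    by (simp only: poly_mult poly_smult divide_inverse mult_1 mult_ac)
qed simp

text \<open>The Laplacian is symmetric, so its characteristic polynomial splits over the reals.
  Counting eigenvalues in this way shows later that the cubic has no non-real roots.\<close>

lemma size_normalized_laplacian_spectrum:
  assumes "pair_graph G"
  shows "size (normalized_laplacian_spectrum G) = card (pverts G)"
proof -
  interpret pair_graph G by fact
  obtain vs where vs: "distinct vs" "set vs = pverts G" using finite_distinct_list[OF pair_finite_verts] by metis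
  have L: "normalized_laplacian G vs \<in> carrier_mat (length vs) (length vs)"
    by (simp add: normalized_laplacian_entries)
  obtain as where as: "char_poly (normalized_laplacian G vs) = (\<Prod>a\<leftarrow>as. [:- a, 1:])" "length as = length vs"
    by (rule symmetric_char_poly_splits[OF L])
       (use arcs_symmetric in \<open>auto simp: normalized_laplacian_entries mult.commute\<close>)
  show ?thesis
    using as vs by (simp add: normalized_laplacian_spectrum_eq[OF vs] proots_prod_linear distinct_card[OF vs(1), symmetric])
qed

text \<open>The claims on \<open>size\<close> say that the cubic has three real roots with
  multiplicity, so that \<open>proots\<close>, taken over the reals, misses none of them.\<close>

theorem theorem6p4:
  fixes G1 :: "'a pair_pre_digraph" and G2 :: "'b pair_pre_digraph"
    and n1 n2 r1 r2 :: nat and S :: "nat set"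
  assumes "pair_graph G1" and "card (pverts G1) = n1" and "regular_graph G1 r1" and "r1 \<ge> 1"
    and "pair_graph G2" and "card (pverts G2) = n2" and "regular_graph G2 r2"
    and "n1 \<ge> 1" and "n2 \<ge> 1"
    and S: "S = {i \<in> {2..n1}. nl_eigenvalue G1 i = 1 + 1 / real r1}"
  shows
    "(S = {} \<longrightarrow>
        size (proots (nns_cubic n1 n2 r1 r2)) = 3 \<and>
        normalized_laplacian_spectrum (nns_join G1 G2) =
          {# 1 + real r2 * (nl_eigenvalue G2 i - 1) / (real n1 + real r2). i \<in># mset_set {2..n2} #}
          + (\<Sum>i\<in>{2..n1}. {# nns_value n1 n2 r1 (nl_eigenvalue G1 i) (-1),
                               nns_value n1 n2 r1 (nl_eigenvalue G1 i) 1 #})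
          + proots (nns_cubic n1 n2 r1 r2))
   \<and> (S = {2..n1} \<longrightarrow>
        normalized_laplacian_spectrum (nns_join G1 G2) =
          {# 1 + real r2 * (nl_eigenvalue G2 i - 1) / (real n1 + real r2). i \<in># mset_set {2..n2} #}
          + replicate_mset (n1 - 1) (1 + 1 / (real n1 + real n2 - 1))
          + replicate_mset (n1 + 1) 0
          + {# (real n1 ^ 2 + 2 * real n1 * real n2 + real r2 * real n2 - real n1)
               / ((real r2 + real n1) * (real n1 + real n2 - 1)) #})
   \<and> (S \<noteq> {} \<and> S \<noteq> {2..n1} \<longrightarrow>
        size (proots (nns_cubic n1 n2 r1 r2)) = 3 \<and>
        normalized_laplacian_spectrum (nns_join G1 G2) =
          {# 1 + real r2 * (nl_eigenvalue G2 i - 1) / (real n1 + real r2). i \<in># mset_set {2..n2} #}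
          + (\<Sum>i\<in>{2..n1} - S. {# nns_value n1 n2 r1 (nl_eigenvalue G1 i) (-1),
                               nns_value n1 n2 r1 (nl_eigenvalue G1 i) 1 #})
          + replicate_mset (card S) 1
          + replicate_mset (card S) (1 + 1 / (real n1 + real n2 - 1))
          + proots (nns_cubic n1 n2 r1 r2))"
proof -
  note G1 = \<open>pair_graph G1\<close> \<open>regular_graph G1 r1\<close> and G2 = \<open>pair_graph G2\<close> \<open>regular_graph G2 r2\<close>
  interpret G1: pair_graph G1 by fact
  interpret G2: pair_graph G2 by fact
  obtain us where us: "distinct us" "set us = pverts G1"
    using finite_distinct_list[OF G1.pair_finite_verts] by metis
  obtain ws where ws: "distinct ws" "set ws = pverts G2"
    using finite_distinct_list[OF G2.pair_finite_verts] by metis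
  have lus: "length us = n1" and lws: "length ws = n2"
    using us ws assms(2,6) distinct_card by metis+
  obtain k1 where k1: "n1 = Suc k1" using \<open>n1 \<ge> 1\<close> by (cases n1) auto
  obtain k2 where k2: "n2 = Suc k2" using \<open>n2 \<ge> 1\<close> by (cases n2) auto
  have "us ! 0 \<in> pverts G1" using us lus k1 nth_mem[of 0 us] by simp
  from card_non_neighbours(1)[OF G1 this] have rn: "r1 + 1 \<le> n1" using assms(2) by simp
  have n1: "2 \<le> n1" using rn \<open>r1 \<ge> 1\<close> by simp
  \<comment> \<open>The nontrivial adjacency eigenvalue belonging to the \<open>i\<close>-th
    Laplacian eigenvalue; it is \<open>- 1\<close> exactly for \<open>i\<close> in
    \<open>S\<close>.\<close>
  define h where "h i = r1 * (1 - nl_eigenvalue G1 i)" for i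
  define es where "es = map h [2..<Suc n1]"
  define fs where "fs = map (\<lambda>i. r2 * (1 - nl_eigenvalue G2 i)) [2..<Suc n2]"
  have es: "char_poly (deflate (adjacency_mat G1 us)) = (\<Prod>e\<leftarrow>es. [:- e, 1:])"
    unfolding es_def h_def k1
    by (rule regular_graph_spectrum[OF G1(1) us _ G1(2)]) (simp add: lus k1)
  have fs: "char_poly (deflate (adjacency_mat G2 ws)) = (\<Prod>e\<leftarrow>fs. [:- e, 1:])"
    unfolding fs_def k2
    by (rule regular_graph_spectrum[OF G2(1) ws _ G2(2)]) (simp add: lws k2)
  have les: "length es = n1 - 1" unfolding es_def by (simp del: upt_Suc)
  have hS: "h i = - 1 \<longleftrightarrow> i \<in> S" if "i \<in> {2..n1}" for i
    using that \<open>r1 \<ge> 1\<close> unfolding S h_def by (auto simp: field_simps)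
  have SI: "S \<subseteq> {2..n1}" unfolding S by auto
  have "(\<forall>e\<in>set es. e = - 1) \<longleftrightarrow> S = {2..n1}"
    using hS SI by (auto simp: es_def simp del: upt_Suc)
  \<comment> \<open>So case (b) is exactly the case of a complete first graph.\<close>
  then have full: "S = {2..n1} \<longleftrightarrow> n1 = Suc r1"
    using regular_complete_iff[OF G1 us _ es, of k1] lus les k1 by auto
  define vs :: "(('a + 'b) + 'a) list"
    where "vs = map (\<lambda>u. Inl (Inl u)) us @ map (\<lambda>w. Inl (Inr w)) ws @ map Inr us"
  have "distinct vs" "set vs = pverts (nns_join G1 G2)"
    using us ws by (auto simp: vs_def distinct_map inj_on_def nns_join_def graph_join_def)
  note spec = normalized_laplacian_spectrum_eq[OF this]
  have msfs: "mset (map (\<lambda>f. 1 - f / (real n1 + real r2)) fs)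
      = {# 1 + real r2 * (nl_eigenvalue G2 i - 1) / (real n1 + real r2). i \<in># mset_set {2..n2} #}"
    (is "_ = ?F")
  proof -
    have "map (\<lambda>f. 1 - f / (real n1 + real r2)) fs
        = map (\<lambda>i. 1 + real r2 * (nl_eigenvalue G2 i - 1) / (real n1 + real r2)) [2..<Suc n2]"
      using n1 unfolding fs_def by (simp add: field_simps del: upt_Suc)
    then show ?thesis by (simp add: atLeastLessThanSuc_atLeastAtMost del: upt_Suc)
  qed
  have complete: "normalized_laplacian_spectrum (nns_join G1 G2) =
          ?F + replicate_mset (n1 - 1) (1 + 1 / (real n1 + real n2 - 1))
          + replicate_mset (n1 + 1) 0
          + {# (real n1 ^ 2 + 2 * real n1 * real n2 + real r2 * real n2 - real n1)
               / ((real r2 + real n1) * (real n1 + real n2 - 1)) #}" if "S = {2..n1}"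
  proof -
    have "\<forall>e\<in>set es. e = - 1" using hS that by (auto simp: es_def simp del: upt_Suc)
    then have "es = replicate (n1 - 1) (- 1)" using les by (metis replicate_length_same)
    then have es': "char_poly (deflate (adjacency_mat G1 us)) = (\<Prod>e\<leftarrow>replicate (n1 - 1) (- 1). [:- e, 1:])"
      using es by simp
    have r: "n1 = Suc r1" using that full by simp
    show ?thesis
      unfolding spec vs_def char_poly_nns_join_complete[OF G1 us lus G2 ws lws n1 \<open>n2 \<ge> 1\<close> es' fs r]
        proots_prod_linear mset_append msfs mset_replicate
      by (simp only: mset.simps add_ac)
  qed
  define Q where "Q e = [:1 - e / (real n1 + real n2 - 1) - (1 + e)\<^sup>2 / ((real n1 + real n2 - 1) * (real n1 - real r1 - 1)),
            e / (real n1 + real n2 - 1) - 2, 1:]" for e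
  \<comment> \<open>Cases (a) and (c) are treated together: for \<open>S = {}\<close> the terms with
    \<open>card S\<close> vanish.\<close>
  have part: "size (proots (nns_cubic n1 n2 r1 r2)) = 3 \<and>
        normalized_laplacian_spectrum (nns_join G1 G2) =
          ?F + (\<Sum>i\<in>{2..n1} - S. {# nns_value n1 n2 r1 (nl_eigenvalue G1 i) (-1),
                               nns_value n1 n2 r1 (nl_eigenvalue G1 i) 1 #})
          + replicate_mset (card S) 1
          + replicate_mset (card S) (1 + 1 / (real n1 + real n2 - 1))
          + proots (nns_cubic n1 n2 r1 r2)" if "S \<noteq> {2..n1}"
  proof -
    have r: "Suc r1 < n1" using full that rn by simp
    have pos: "real n1 - real r1 - 1 > 0" "real n1 + real n2 - 1 > 0" "real n1 + real r2 > 0"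
      using r n1 by auto
    have Qh: "proots (Q (h i)) = (if i \<in> S then {#1, 1 + 1 / (real n1 + real n2 - 1)#}
       else {# nns_value n1 n2 r1 (nl_eigenvalue G1 i) (-1), nns_value n1 n2 r1 (nl_eigenvalue G1 i) 1 #})"
      if "i \<in> {2..n1}" for i
      unfolding Q_def using proots_nns_quadratic[OF pos(1,2) h_def[of i]] hS[OF that] by simp
    have esQ: "(\<Prod>e\<leftarrow>es. Q e) = (\<Prod>i\<in>{2..n1}. Q (h i))"
      unfolding es_def using prod.distinct_set_conv_list[of "[2..<Suc n1]" "\<lambda>i. Q (h i)"]
      by (simp add: o_def atLeastLessThanSuc_atLeastAtMost del: upt_Suc)
    have "coeff (nns_cubic n1 n2 r1 r2) 3 = (real n1 + real n2 - 1) * (real n1 + real r2)"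
      by (simp add: nns_cubic_def numeral_3_eq_3 power2_eq_square algebra_simps)
    then have cne: "nns_cubic n1 n2 r1 r2 \<noteq> 0" using pos by auto
    have cp: "char_poly (normalized_laplacian (nns_join G1 G2) vs)
        = (\<Prod>e\<leftarrow>map (\<lambda>f. 1 - f / (real n1 + real r2)) fs. [:- e, 1:]) * (\<Prod>i\<in>{2..n1}. Q (h i))
          * Polynomial.smult (1 / ((real n1 + real n2 - 1) * (real n1 + real r2))) (nns_cubic n1 n2 r1 r2)"
      unfolding esQ[symmetric] unfolding vs_def Q_def
      using char_poly_nns_join_noncomplete[OF G1 us lus G2 ws lws n1 _ es les fs r] k2 by simp
    have ne: "(\<Prod>e\<leftarrow>map (\<lambda>f. 1 - f / (real n1 + real r2)) fs. [:- e, 1:]) \<noteq> 0"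
      "(\<Prod>i\<in>{2..n1}. Q (h i)) \<noteq> 0"
      by (auto simp: prod_list_zero_iff Q_def)
    have sp: "normalized_laplacian_spectrum (nns_join G1 G2)
        = ?F + (\<Sum>i\<in>{2..n1}. proots (Q (h i))) + proots (nns_cubic n1 n2 r1 r2)"
      unfolding spec cp using ne cne pos
      by (simp add: proots_mult proots_prod proots_prod_linear msfs Q_def del: map_map mset_map)
    \<comment> \<open>Each quadratic has two real roots. Of the \<open>2 n1 + n2\<close> eigenvalues
      of the join, \<open>n2 - 1\<close> come from the second graph and \<open>2 (n1 - 1)\<close>
      from the quadratics, which leaves three for the cubic.\<close>
    have "size (\<Sum>i\<in>{2..n1}. proots (Q (h i))) = 2 * (n1 - 1)"
    proof -
      have "size (proots (Q (h i))) = 2" if "i \<in> {2..n1}" for i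
        using Qh[OF that] by simp
      then have "(\<Sum>i\<in>{2..n1}. size (proots (Q (h i)))) = (\<Sum>i\<in>{2..n1}. 2)"
        by (intro sum.cong) auto
      then show ?thesis by (simp add: size_multiset_sum)
    qed
    moreover have "size (normalized_laplacian_spectrum (nns_join G1 G2)) = 2 * n1 + n2"
      using size_normalized_laplacian_spectrum[OF pair_graph_nns_join[OF G1(1) G2(1)]] assms(2,6)
        G1.pair_finite_verts G2.pair_finite_verts
      by (simp add: nns_join_def graph_join_def card_Plus)
    ultimately have "size (proots (nns_cubic n1 n2 r1 r2)) = 3"
      using n1 \<open>n2 \<ge> 1\<close> unfolding sp by simp
    moreover have "(\<Sum>i\<in>{2..n1}. proots (Q (h i)))
        = (\<Sum>i\<in>{2..n1} - S. proots (Q (h i))) + (\<Sum>i\<in>S. proots (Q (h i)))"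
      by (rule sum.subset_diff[OF SI]) simp
    moreover have "(\<Sum>i\<in>{2..n1} - S. proots (Q (h i)))
        = (\<Sum>i\<in>{2..n1} - S. {# nns_value n1 n2 r1 (nl_eigenvalue G1 i) (-1),
                               nns_value n1 n2 r1 (nl_eigenvalue G1 i) 1 #})"
      using Qh by (intro sum.cong) auto
    moreover have "(\<Sum>i\<in>S. proots (Q (h i))) = (\<Sum>i\<in>S. {#1, 1 + 1 / (real n1 + real n2 - 1)#})"
      using Qh SI by (intro sum.cong) auto
    moreover have "(\<Sum>i\<in>T. {#a, b#}) = replicate_mset (card T) a + replicate_mset (card T) b"
      if "finite T" for T :: "nat set" and a b :: real
      using that by induction auto
    ultimately show ?thesis
      using sp finite_subset[OF SI] by (simp add: add_ac)
  qed
  \<comment> \<open>As \<open>r1 \<ge> 1\<close> forces \<open>n1 \<ge> 2\<close>, the index range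
    is nonempty and an empty \<open>S\<close> cannot exhaust it.\<close>
  have "S \<noteq> {2..n1}" if "S = {}" using that n1 by auto
  note empty = part[OF this]
  show ?thesis
  proof (intro conjI impI)
    assume "S = {}"
    note e = empty[OF this, unfolded this card.empty replicate_mset_0 Diff_empty empty_neutral add_0_right]
    show "size (proots (nns_cubic n1 n2 r1 r2)) = 3" by (rule conjunct1[OF e])
    show "normalized_laplacian_spectrum (nns_join G1 G2) =
          ?F + (\<Sum>i\<in>{2..n1}. {# nns_value n1 n2 r1 (nl_eigenvalue G1 i) (-1),
                               nns_value n1 n2 r1 (nl_eigenvalue G1 i) 1 #})
          + proots (nns_cubic n1 n2 r1 r2)" by (rule conjunct2[OF e])
  next
    assume "S = {2..n1}"
    then show "normalized_laplacian_spectrum (nns_join G1 G2) =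
          ?F + replicate_mset (n1 - 1) (1 + 1 / (real n1 + real n2 - 1))
          + replicate_mset (n1 + 1) 0
          + {# (real n1 ^ 2 + 2 * real n1 * real n2 + real r2 * real n2 - real n1)
               / ((real r2 + real n1) * (real n1 + real n2 - 1)) #}" by (rule complete)
  next
    assume "S \<noteq> {} \<and> S \<noteq> {2..n1}"
    then have "S \<noteq> {2..n1}" ..
    note p = part[OF this]
    show "size (proots (nns_cubic n1 n2 r1 r2)) = 3" by (rule conjunct1[OF p])
    show "normalized_laplacian_spectrum (nns_join G1 G2) =
          ?F + (\<Sum>i\<in>{2..n1} - S. {# nns_value n1 n2 r1 (nl_eigenvalue G1 i) (-1),
                               nns_value n1 n2 r1 (nl_eigenvalue G1 i) 1 #})
          + replicate_mset (card S) 1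
          + replicate_mset (card S) (1 + 1 / (real n1 + real n2 - 1))
          + proots (nns_cubic n1 n2 r1 r2)" by (rule conjunct2[OF p])
  qed
qed

end
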